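(* Let $\mathbf{s}=\{0\}\cup\{1/n : n\in\mathbb{N}\}$ be endowed with the topology induced from $\mathbb{R}$, and let $A_G(\mathbf{s})$ be the Graev free abelian topological group over $\mathbf{s}$. Then $A_G(\mathbf{s})$ is neither a pre-Mackey group nor a quasi-Mackey group.
   Context: $\mathbb{N}=\{1,2,\dots\}$. $\mathbb{S}$ denotes the unit circle group (complex numbers of modulus $1$ under multiplication, with the usual topology), and $\mathbb{S}_+=\{z\in\mathbb{S} : \mathrm{Re}(z)\ge 0\}$. For an abelian topological group $(G,\tau)$, $\widehat{(G,\tau)}$ (or $\widehat{G}$) denotes the group of all continuous characters, i.e. continuous homomorphisms $(G,\tau)\to\mathbb{S}$. Two group topologies $\mu,\nu$ on an abelian group $G$ are compatible if $\widehat{(G,\mu)}=\widehat{(G,\nu)}$. A subset $A$ of an abelian topological group $G$ is quasi-convex if for every $g\in G\setminus A$ there exists $\chi\in\widehat{G}$ such that $\chi(g)\notin\mathbb{S}_+$ and $\chi(A)\subseteq\mathbb{S}_+$. $G$ is locally quasi-convex if it has a neighborhood base at the neutral element $0$ consisting of quasi-convex sets. A locally quasi-convex abelian group $(G,\mu)$ is a Mackey group (and $\mu$ is a Mackey topology on $G$) if for every locally quasi-convex group topology $\nu$ on $G$ compatible with $\mu$ one has $\nu\le\mu$. A locally quasi-convex abelian group $(G,\tau)$ is a pre-Mackey group if there is a Mackey topology $\mu$ on $G$ associated with $\tau$, i.e. a locally quasi-convex group topology $\mu$ on $G$ that is compatible with $\tau$ and such that $(G,\mu)$ is a Mackey group (equivalently,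 there is a finest locally quasi-convex group topology on $G$ compatible with $\tau$). Let $(G,\tau)$ be a locally quasi-convex abelian group. A locally quasi-convex group topology $\mu$ on $G$ is called quasi-Mackey if $\mu$ is compatible with $\tau$ and there is no locally quasi-convex group topology $\nu$ on $G$ compatible with $\tau$ such that $\mu<\nu$ (i.e. $\nu$ strictly finer than $\mu$). The group $(G,\tau)$ is quasi-Mackey if $\tau$ itself is a quasi-Mackey topology. Let $X$ be a Tychonoff space with a distinguished point $e$. An abelian topological group $A_G(X)$ is the Graev free abelian topological group over $X$ if (i) $X$ is a subspace of $A_G(X)$; (ii) every continuous map $f$ from $X$ into any abelian topological group $H$ sending $e$ to the identity of $H$ extends uniquely to a continuous homomorphism $\bar f:A_G(X)\to H$. It is known that $A_G(X)$ exists, is unique up to isomorphism of abelian topological groups, is independent of the choice of $e\in X$, and is algebraically the free abelian group on $X\setminus\{e\}$ (with $e$ being the identity). It is known that $A_G(\mathbf{s})$ is reflexive, hence locally quasi-convex, so the notions above apply to it. *)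

theory Defs
  imports "HOL-Analysis.Analysis" "HOL-Algebra.Free_Abelian_Groups"
begin

section \<open>Abelian topological groups and their characters\<close>

text \<open>
  Groups are written multiplicatively, as in HOL-Algebra; the neutral element called \<open>0\<close> in additive
  notation is \<open>\<one>\<^bsub>G\<^esub>\<close>. A group topology lives exactly on the carrier. No separation axiom is
  imposed. (For topologies compatible with one whose continuous characters separate points the
  Hausdorff property is automatic.)
\<close>

definition abelian_topological_group :: "('a, 'm) monoid_scheme \<Rightarrow> 'a topology \<Rightarrow> bool"
  where "abelian_topological_group G T \<longleftrightarrow>
    comm_group G \<and> topspace T = carrier G \<and>
    continuous_map (prod_topology T T) T (\<lambda>(x, y). x \<otimes>\<^bsub>G\<^esub> y) \<and>
    continuous_map T T (\<lambda>x. inv\<^bsub>G\<^esub> x)"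

definition circle_group :: "complex monoid"
  where "circle_group = \<lparr>carrier = sphere 0 1, monoid.mult = (*), one = 1\<rparr>"

definition circle_right_half :: "complex set"
  where "circle_right_half = {z \<in> sphere 0 1. Re z \<ge> 0}"

text \<open>
  Characters are made \<^const>\<open>extensional\<close> so that equality of character sets is equality of the
  characters as functions on the carrier.
\<close>

definition continuous_characters ::
    "('a, 'm) monoid_scheme \<Rightarrow> 'a topology \<Rightarrow> ('a \<Rightarrow> complex) set"
  where "continuous_characters G T =
    {\<phi> \<in> hom G circle_group \<inter> extensional (carrier G).
       continuous_map T (top_of_set (sphere 0 1)) \<phi>}"

definition compatible_topologies ::
    "('a, 'm) monoid_scheme \<Rightarrow> 'a topology \<Rightarrow> 'a topology \<Rightarrow> bool"
  where "compatible_topologies G \<mu> \<nu> \<longleftrightarrow>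
    continuous_characters G \<mu> = continuous_characters G \<nu>"

definition coarser_topology :: "'a topology \<Rightarrow> 'a topology \<Rightarrow> bool"
  where "coarser_topology \<nu> \<mu> \<longleftrightarrow> (\<forall>U. openin \<nu> U \<longrightarrow> openin \<mu> U)"


section \<open>Local quasi-convexity and Mackey-type properties\<close>

definition quasi_convex :: "('a, 'm) monoid_scheme \<Rightarrow> 'a topology \<Rightarrow> 'a set \<Rightarrow> bool"
  where "quasi_convex G T A \<longleftrightarrow>
    A \<subseteq> carrier G \<and>
    (\<forall>g \<in> carrier G - A. \<exists>\<phi> \<in> continuous_characters G T.
       \<phi> g \<notin> circle_right_half \<and> \<phi> ` A \<subseteq> circle_right_half)"

definition lqc_group :: "('a, 'm) monoid_scheme \<Rightarrow> 'a topology \<Rightarrow> bool"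
  where "lqc_group G T \<longleftrightarrow>
    abelian_topological_group G T \<and> neighbourhood_base_at \<one>\<^bsub>G\<^esub> (quasi_convex G T) T"

definition Mackey_group :: "('a, 'm) monoid_scheme \<Rightarrow> 'a topology \<Rightarrow> bool"
  where "Mackey_group G \<mu> \<longleftrightarrow>
    lqc_group G \<mu> \<and>
    (\<forall>\<nu>. lqc_group G \<nu> \<and> compatible_topologies G \<mu> \<nu> \<longrightarrow> coarser_topology \<nu> \<mu>)"

definition pre_Mackey_group :: "('a, 'm) monoid_scheme \<Rightarrow> 'a topology \<Rightarrow> bool"
  where "pre_Mackey_group G \<tau> \<longleftrightarrow>
    lqc_group G \<tau> \<and>
    (\<exists>\<mu>. lqc_group G \<mu> \<and> compatible_topologies G \<tau> \<mu> \<and> Mackey_group G \<mu>)"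

definition quasi_Mackey_topology ::
    "('a, 'm) monoid_scheme \<Rightarrow> 'a topology \<Rightarrow> 'a topology \<Rightarrow> bool"
  where "quasi_Mackey_topology G \<tau> \<mu> \<longleftrightarrow>
    lqc_group G \<mu> \<and> compatible_topologies G \<tau> \<mu> \<and>
    \<not> (\<exists>\<nu>. lqc_group G \<nu> \<and> compatible_topologies G \<tau> \<nu> \<and>
           coarser_topology \<mu> \<nu> \<and> \<mu> \<noteq> \<nu>)"

definition quasi_Mackey_group :: "('a, 'm) monoid_scheme \<Rightarrow> 'a topology \<Rightarrow> bool"
  where "quasi_Mackey_group G \<tau> \<longleftrightarrow> lqc_group G \<tau> \<and> quasi_Mackey_topology G \<tau> \<tau>"


section \<open>The Graev free abelian topological group\<close>

text \<open>
  \<open>graev_free_abelian_group A T X e \<iota>\<close>: the topological group \<open>(A, T)\<close> together with the topological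
  embedding \<open>\<iota>\<close> of \<open>X\<close> is the Graev free abelian topological group over the pointed Tychonoff space
  \<open>(X, e)\<close>. A definition cannot quantify over types, so the universal property is required for the
  groups \<open>H\<close> carried by subsets of the fixed type of finite signed words over the type of \<open>A\<close>.
  This is no restriction: the theorem \<open>graev_free_universal\<close> below derives the universal property
  for abelian topological groups of an arbitrary type.
\<close>

definition graev_free_abelian_group ::
    "('a, 'm) monoid_scheme \<Rightarrow> 'a topology \<Rightarrow> 'x topology \<Rightarrow> 'x \<Rightarrow> ('x \<Rightarrow> 'a) \<Rightarrow> bool"
  where "graev_free_abelian_group A T X e \<iota> \<longleftrightarrow>
    completely_regular_space X \<and> Hausdorff_space X \<and> e \<in> topspace X \<and>
    abelian_topological_group A T \<and>
    embedding_map X T \<iota> \<and> \<iota> e = \<one>\<^bsub>A\<^esub> \<and>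
    (\<forall>(H :: (bool \<times> 'a) list monoid) TH f.
       abelian_topological_group H TH \<and> continuous_map X TH f \<and> f e = \<one>\<^bsub>H\<^esub> \<longrightarrow>
       (\<exists>!h. h \<in> hom A H \<inter> extensional (carrier A) \<and> continuous_map T TH h \<and>
             (\<forall>x \<in> topspace X. h (\<iota> x) = f x)))"

definition conv_seq :: "real set"
  where "conv_seq = insert 0 {1 / real n | n. n \<ge> 1}"


section \<open>Sanity results for the definition of the Graev free group\<close>

lemma pullback_abelian_topological_group:
  assumes G: "comm_group G" and H: "abelian_topological_group H TH" and h: "h \<in> hom G H"
  shows "abelian_topological_group G (pullback_topology (carrier G) h TH)"
proof -
  let ?T = "pullback_topology (carrier G) h TH"
  interpret G: comm_group G by fact
  interpret H: comm_group H using H by (simp add: abelian_topological_group_def)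
  interpret group_hom G H h
    using h by (simp add: group_hom_def group_hom_axioms_def G.is_group H.is_group)
  have tH: "topspace TH = carrier H" using H by (simp add: abelian_topological_group_def)
  have tT: "topspace ?T = carrier G" by (auto simp: topspace_pullback_topology tH)
  have ch: "continuous_map ?T TH h"
    using continuous_map_pullback[OF continuous_map_id, of "carrier G" h TH] by (simp add: comp_def)
  have mH: "continuous_map (prod_topology TH TH) TH (\<lambda>(x, y). x \<otimes>\<^bsub>H\<^esub> y)"
    and iH: "continuous_map TH TH (\<lambda>x. inv\<^bsub>H\<^esub> x)"
    using H by (auto simp: abelian_topological_group_def)
  have "continuous_map (prod_topology ?T ?T) TH (h \<circ> (\<lambda>(x, y). x \<otimes>\<^bsub>G\<^esub> y))"
  proof (rule continuous_map_eq)
    show "continuous_map (prod_topology ?T ?T) TH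
            ((\<lambda>(x, y). x \<otimes>\<^bsub>H\<^esub> y) \<circ> (\<lambda>p. (h (fst p), h (snd p))))"
      by (rule continuous_map_compose[OF _ mH], rule continuous_map_pairedI)
         (use continuous_map_compose[OF continuous_map_fst ch]
              continuous_map_compose[OF continuous_map_snd ch] in \<open>auto simp: comp_def\<close>)
  qed (auto simp: tT)
  then have "continuous_map (prod_topology ?T ?T) ?T (\<lambda>(x, y). x \<otimes>\<^bsub>G\<^esub> y)"
    by (rule continuous_map_pullback') (auto simp: tT)
  moreover have "continuous_map ?T TH (h \<circ> (\<lambda>x. inv\<^bsub>G\<^esub> x))"
    by (rule continuous_map_eq[OF continuous_map_compose[OF ch iH]]) (auto simp: tT)
  then have "continuous_map ?T ?T (\<lambda>x. inv\<^bsub>G\<^esub> x)"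
    by (rule continuous_map_pullback') (auto simp: tT)
  ultimately show ?thesis
    by (simp add: abelian_topological_group_def tT G)
qed

text \<open>A copy, inside another type, of a subgroup of an abelian topological group.\<close>

lemma subgroup_copy:
  fixes H :: "('h, 'n) monoid_scheme" and r :: "'h \<Rightarrow> 'w"
  assumes H: "abelian_topological_group H TH" and K: "subgroup K H" and r: "inj_on r K"
  obtains H' :: "'w monoid" and s where
    "abelian_topological_group H' (pullback_topology (r ` K) s TH)"
    "carrier H' = r ` K" "s \<in> hom H' H" "\<And>x. x \<in> K \<Longrightarrow> s (r x) = x" "\<one>\<^bsub>H'\<^esub> = r \<one>\<^bsub>H\<^esub>"
    "\<And>x y. x \<in> K \<Longrightarrow> y \<in> K \<Longrightarrow> r x \<otimes>\<^bsub>H'\<^esub> r y = r (x \<otimes>\<^bsub>H\<^esub> y)"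
proof -
  interpret H: comm_group H using H by (simp add: abelian_topological_group_def)
  interpret K: subgroup K H by fact
  define s where "s = inv_into K r"
  define H' where "H' = \<lparr>carrier = r ` K, monoid.mult = (\<lambda>x y. r (s x \<otimes>\<^bsub>H\<^esub> s y)), one = r \<one>\<^bsub>H\<^esub>\<rparr>"
  have sr: "s (r x) = x" if "x \<in> K" for x using that r by (simp add: s_def)
  have comm: "comm_group H'"
  proof (rule comm_groupI)
    fix x assume "x \<in> carrier H'"
    then obtain k where "k \<in> K" "x = r k" by (auto simp: H'_def)
    then show "\<exists>y\<in>carrier H'. y \<otimes>\<^bsub>H'\<^esub> x = \<one>\<^bsub>H'\<^esub>"
      by (intro bexI[of _ "r (inv\<^bsub>H\<^esub> k)"]) (auto simp: H'_def sr)
  qed (auto simp: H'_def sr H.m_ac)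
  have hom: "s \<in> hom H' H" by (auto simp: hom_def H'_def sr)
  show thesis
  proof (rule that[of H' s])
    show "abelian_topological_group H' (pullback_topology (r ` K) s TH)"
      using pullback_abelian_topological_group[OF comm H hom] by (simp add: H'_def)
  qed (use hom sr in \<open>auto simp: H'_def\<close>)
qed

lemma subgroup_hom_image:
  assumes "comm_group G" "comm_group H" "h \<in> hom G H"
  shows "subgroup (h ` carrier G) H"
proof -
  interpret group_hom G H h
    using assms by (simp add: group_hom_def group_hom_axioms_def comm_group_def)
  show ?thesis by (rule img_is_subgroup)
qed

theorem graev_free_universal:
  fixes A :: "('a, 'm) monoid_scheme" and H :: "('h, 'n) monoid_scheme"
  assumes F: "graev_free_abelian_group A T X e \<iota>"
    and H: "abelian_topological_group H TH" and f: "continuous_map X TH f" "f e = \<one>\<^bsub>H\<^esub>"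
  shows "\<exists>!h. h \<in> hom A H \<inter> extensional (carrier A) \<and> continuous_map T TH h \<and>
              (\<forall>x \<in> topspace X. h (\<iota> x) = f x)"
proof -
  have A: "abelian_topological_group A T" and emb: "embedding_map X T \<iota>" and \<iota>e: "\<iota> e = \<one>\<^bsub>A\<^esub>"
    and eX: "e \<in> topspace X"
    using F by (auto simp: graev_free_abelian_group_def)
  have univ: "\<exists>!h. h \<in> hom A H' \<inter> extensional (carrier A) \<and> continuous_map T TH' h \<and>
              (\<forall>x \<in> topspace X. h (\<iota> x) = f' x)"
    if "abelian_topological_group H' TH'" "continuous_map X TH' f'" "f' e = \<one>\<^bsub>H'\<^esub>"
    for H' :: "(bool \<times> 'a) list monoid" and TH' f'
    using F that unfolding graev_free_abelian_group_def by blast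
  interpret A: comm_group A using A by (simp add: abelian_topological_group_def)
  interpret H: comm_group H using H by (simp add: abelian_topological_group_def)
  have tT: "topspace T = carrier A" and tH: "topspace TH = carrier H"
    using A H by (auto simp: abelian_topological_group_def)
  have \<iota>A: "\<iota> x \<in> carrier A" if "x \<in> topspace X" for x
  proof -
    have "homeomorphic_map X (subtopology T (\<iota> ` topspace X)) \<iota>"
      using emb by (simp add: embedding_map_def)
    then have "continuous_map X T \<iota>"
      using homeomorphic_imp_continuous_map continuous_map_in_subtopology by blast
    then show ?thesis using that tT by (auto simp: continuous_map_def)
  qed
  have fH: "f x \<in> carrier H" if "x \<in> topspace X" for x
    using f that tH by (auto simp: continuous_map_def)
  have inj: "inj_on \<iota> (topspace X)"
    using emb by (metis embedding_map_def homeomorphic_imp_injective_map)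
  txt \<open>Existence: factor through a copy of the subgroup generated by the range of \<open>f\<close>.\<close>
  define g where "g = (\<lambda>a. f (inv_into (topspace X) \<iota> a))"
  define ev where "ev = (\<lambda>w::(bool \<times> 'a) list.
    foldr (\<lambda>p y. (if fst p then g (snd p) else inv\<^bsub>H\<^esub> (g (snd p))) \<otimes>\<^bsub>H\<^esub> y) w \<one>\<^bsub>H\<^esub>)"
  define W where "W = {w :: (bool \<times> 'a) list. \<forall>p\<in>set w. snd p \<in> \<iota> ` topspace X}"
  define K where "K = ev ` W"
  have gi: "g (\<iota> x) = f x" if "x \<in> topspace X" for x using that inj by (simp add: g_def)
  have ev0: "ev [] = \<one>\<^bsub>H\<^esub>" by (simp add: ev_def)
  have evC: "ev (p # w) = (if fst p then g (snd p) else inv\<^bsub>H\<^esub> (g (snd p))) \<otimes>\<^bsub>H\<^esub> ev w" for p w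
    by (simp add: ev_def)
  have W0: "[] \<in> W" by (simp add: W_def)
  have WC: "p # w \<in> W \<longleftrightarrow> snd p \<in> \<iota> ` topspace X \<and> w \<in> W" for p w by (auto simp: W_def)
  have gH: "g a \<in> carrier H" if "a \<in> \<iota> ` topspace X" for a using that gi fH by auto
  have evH: "w \<in> W \<Longrightarrow> ev w \<in> carrier H" for w
    by (induction w) (auto simp: ev0 evC WC intro!: gH)
  have evapp: "w \<in> W \<Longrightarrow> v \<in> W \<Longrightarrow> ev (w @ v) = ev w \<otimes>\<^bsub>H\<^esub> ev v" for w v
    by (induction w) (auto simp: ev0 evC WC H.m_assoc gH evH simp del: split_paired_All)
  have evinv: "w \<in> W \<Longrightarrow> ev (map (\<lambda>p. (\<not> fst p, snd p)) w) = inv\<^bsub>H\<^esub> (ev w)" for w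
    by (induction w) (auto simp: ev0 evC WC H.inv_mult gH evH)
  have K: "subgroup K H"
  proof (rule H.subgroupI)
    show "K \<subseteq> carrier H" using evH by (auto simp: K_def)
    show "K \<noteq> {}" using W0 by (auto simp: K_def)
    show "inv\<^bsub>H\<^esub> k \<in> K" if k: "k \<in> K" for k
    proof -
      obtain w where w: "w \<in> W" "k = ev w" using k by (auto simp: K_def)
      then have "map (\<lambda>p. (\<not> fst p, snd p)) w \<in> W" by (auto simp: W_def)
      then show ?thesis using evinv w by (metis K_def image_eqI)
    qed
    show "k \<otimes>\<^bsub>H\<^esub> l \<in> K" if kl: "k \<in> K" "l \<in> K" for k l
    proof -
      obtain w v where w: "w \<in> W" "k = ev w" "v \<in> W" "l = ev v" using kl by (auto simp: K_def)
      then have "w @ v \<in> W" by (auto simp: W_def)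
      then show ?thesis using evapp w by (metis K_def image_eqI)
    qed
  qed
  have fK: "f x \<in> K" if "x \<in> topspace X" for x
  proof -
    have "[(True, \<iota> x)] \<in> W" using that by (simp add: W_def)
    moreover have "ev [(True, \<iota> x)] = f x" using that fH by (simp add: evC ev0 gi)
    ultimately show ?thesis by (metis K_def image_eqI)
  qed
  define r where "r = inv_into W ev"
  have rK: "inj_on r K" unfolding r_def K_def by (rule inj_on_inv_into) simp
  obtain H' :: "(bool \<times> 'a) list monoid" and s where
    H': "abelian_topological_group H' (pullback_topology (r ` K) s TH)"
    "carrier H' = r ` K" "s \<in> hom H' H" "\<And>x. x \<in> K \<Longrightarrow> s (r x) = x" "\<one>\<^bsub>H'\<^esub> = r \<one>\<^bsub>H\<^esub>"
    by (rule subgroup_copy[OF H K rK], rule that; assumption)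
  let ?TH' = "pullback_topology (r ` K) s TH"
  have "continuous_map X TH (s \<circ> (r \<circ> f))"
    by (rule continuous_map_eq[OF f(1)]) (simp add: H'(4) fK)
  then have "continuous_map X ?TH' (r \<circ> f)"
    by (rule continuous_map_pullback') (auto simp: fK)
  from univ[OF H'(1) this] obtain h where
    h: "h \<in> hom A H'" "continuous_map T ?TH' h" "\<And>x. x \<in> topspace X \<Longrightarrow> h (\<iota> x) = r (f x)"
    using H'(5) f(2) by auto
  have cs: "continuous_map ?TH' TH s"
    using continuous_map_pullback[OF continuous_map_id, of "r ` K" s TH] by (simp add: comp_def)
  define h0 where "h0 = restrict (s \<circ> h) (carrier A)"
  have "s \<circ> h \<in> hom A H" using h(1) H'(3) by (rule hom_compose)
  then have "h0 \<in> hom A H \<inter> extensional (carrier A)"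
    by (auto simp: h0_def hom_def Pi_def)
  moreover have "continuous_map T TH h0"
    by (rule continuous_map_eq[OF continuous_map_compose[OF h(2) cs]]) (simp add: h0_def tT)
  moreover have "\<forall>x\<in>topspace X. h0 (\<iota> x) = f x"
    by (simp add: h0_def \<iota>A h(3) H'(4) fK)
  moreover
  txt \<open>Uniqueness: the quotient of two extensions has a range that embeds as a set into \<open>A\<close>.\<close>
  have "h1 = h2"
    if 1: "h1 \<in> hom A H" "h1 \<in> extensional (carrier A)" "\<forall>x\<in>topspace X. h1 (\<iota> x) = f x"
      and 2: "h2 \<in> hom A H" "h2 \<in> extensional (carrier A)" "\<forall>x\<in>topspace X. h2 (\<iota> x) = f x"
    for h1 h2
  proof -
    interpret h1: group_hom A H h1
      using 1 by (simp add: group_hom_def group_hom_axioms_def A.is_group H.is_group)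
    interpret h2: group_hom A H h2
      using 2 by (simp add: group_hom_def group_hom_axioms_def A.is_group H.is_group)
    define d where "d = (\<lambda>a. h1 a \<otimes>\<^bsub>H\<^esub> inv\<^bsub>H\<^esub> (h2 a))"
    have d: "d \<in> hom A H"
      by (auto simp: hom_def d_def H.inv_mult H.m_ac)
    define D where "D = d ` carrier A"
    have D: "subgroup D H"
      unfolding D_def using A.comm_group_axioms H.comm_group_axioms d by (rule subgroup_hom_image)
    define I where "I = pullback_topology (carrier H) (\<lambda>_. \<one>\<^bsub>H\<^esub>) TH"
    have I: "abelian_topological_group H I"
      unfolding I_def using H.comm_group_axioms H
      by (rule pullback_abelian_topological_group) (simp add: hom_def)
    define \<rho> where "\<rho> = (\<lambda>y. [(True, inv_into (carrier A) d y)])"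
    have \<rho>D: "inj_on \<rho> D"
      by (rule inj_onI) (auto simp: \<rho>_def D_def dest: inv_into_injective)
    obtain H' :: "(bool \<times> 'a) list monoid" and s where
      H': "abelian_topological_group H' (pullback_topology (\<rho> ` D) s I)"
      "carrier H' = \<rho> ` D" "s \<in> hom H' H" "\<And>x. x \<in> D \<Longrightarrow> s (\<rho> x) = x" "\<one>\<^bsub>H'\<^esub> = \<rho> \<one>\<^bsub>H\<^esub>"
      "\<And>x y. x \<in> D \<Longrightarrow> y \<in> D \<Longrightarrow> \<rho> x \<otimes>\<^bsub>H'\<^esub> \<rho> y = \<rho> (x \<otimes>\<^bsub>H\<^esub> y)"
      by (rule subgroup_copy[OF I D \<rho>D], rule that; assumption)
    let ?TH' = "pullback_topology (\<rho> ` D) s I"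
    interpret H': comm_group H' using H'(1) by (simp add: abelian_topological_group_def)
    have tH': "topspace ?TH' = carrier H'" using H'(1) by (simp add: abelian_topological_group_def)
    have any: "continuous_map Y ?TH' k" if "k \<in> topspace Y \<rightarrow> carrier H'" for Y :: "'y topology" and k
    proof (rule continuous_map_pullback')
      have "continuous_map Y I (s \<circ> k)"
        unfolding I_def
      proof (rule continuous_map_pullback')
        show "continuous_map Y TH ((\<lambda>_. \<one>\<^bsub>H\<^esub>) \<circ> (s \<circ> k))" by (simp add: comp_def tH)
        show "topspace Y \<subseteq> (s \<circ> k) -` carrier H"
          using that H'(3) by (auto simp: hom_def)
      qed
      then show "continuous_map Y I (s \<circ> k)" .
      show "topspace Y \<subseteq> k -` \<rho> ` D" using that unfolding H'(2) by (auto simp: Pi_iff)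
    qed
    define k1 where "k1 = restrict (\<rho> \<circ> d) (carrier A)"
    define k2 where "k2 = restrict (\<lambda>_. \<one>\<^bsub>H'\<^esub>) (carrier A)"
    have oH: "\<one>\<^bsub>H'\<^esub> \<in> carrier H'" by simp
    have k1: "k1 \<in> hom A H' \<inter> extensional (carrier A)"
      using d by (auto simp: k1_def hom_def D_def H'(2) H'(6)[unfolded D_def])
    have k2: "k2 \<in> hom A H' \<inter> extensional (carrier A)"
      by (auto simp: k2_def hom_def)
    have dx: "d (\<iota> x) = \<one>\<^bsub>H\<^esub>" if "x \<in> topspace X" for x
      using that 1(3) 2(3) fH by (simp add: d_def)
    have c: "continuous_map X ?TH' (\<lambda>_. \<one>\<^bsub>H'\<^esub>)" using oH by (intro any) auto
    have "k1 = k2"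
    proof (rule ex1E[OF univ[OF H'(1) c refl]])
      fix k assume k: "\<forall>k'. k' \<in> hom A H' \<inter> extensional (carrier A) \<and> continuous_map T ?TH' k' \<and>
              (\<forall>x \<in> topspace X. k' (\<iota> x) = \<one>\<^bsub>H'\<^esub>) \<longrightarrow> k' = k"
      have "continuous_map T ?TH' k1" "continuous_map T ?TH' k2"
        using k1 k2 by (auto intro!: any simp: tT hom_def)
      moreover have "\<forall>x \<in> topspace X. k1 (\<iota> x) = \<one>\<^bsub>H'\<^esub>" "\<forall>x \<in> topspace X. k2 (\<iota> x) = \<one>\<^bsub>H'\<^esub>"
        using \<iota>A by (simp_all add: k1_def k2_def dx H'(5))
      ultimately show "k1 = k2" using k k1 k2 by metis
    qed
    then have "\<rho> (d a) = \<rho> \<one>\<^bsub>H\<^esub>" if "a \<in> carrier A" for a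
      using that H'(5) by (auto simp: k1_def k2_def fun_eq_iff restrict_def split: if_splits)
    then have da: "d a = \<one>\<^bsub>H\<^esub>" if "a \<in> carrier A" for a
      using that H'(4)[of "d a"] H'(4)[of "\<one>\<^bsub>H\<^esub>"] subgroup.one_closed[OF D] by (simp add: D_def)
    show "h1 = h2"
    proof (rule extensionalityI[OF 1(2) 2(2)])
      fix a assume a: "a \<in> carrier A"
      then have "h1 a \<in> carrier H" "h2 a \<in> carrier H" by auto
      then show "h1 a = h2 a"
        using da[OF a] by (metis d_def H.inv_closed H.inv_equality H.inv_inv)
    qed
  qed
  ultimately show ?thesis by (intro ex1I[of _ h0]) auto
qed

text \<open>
  Graev free groups over spaces of reals, in particular over \<^const>\<open>conv_seq\<close>, exist: take the free
  abelian group with the supremum of all group topologies that make the canonical map continuous.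
\<close>

theorem graev_free_exists:
  fixes S :: "real set"
  assumes e: "e \<in> S"
  defines "F \<equiv> free_Abelian_group (S - {e})"
    and "j \<equiv> (\<lambda>x. if x = e then 0 else frag_of x)"
  shows "\<exists>T. graev_free_abelian_group F T (top_of_set S) e j"
proof -
  let ?X = "top_of_set S"
  define \<T> where "\<T> = {T'. abelian_topological_group F T' \<and> continuous_map ?X T' j}"
  define T where "T = topology_generated_by {U. \<exists>T'\<in>\<T>. openin T' U}"
  have F: "comm_group F" unfolding F_def by (rule abelian_free_Abelian_group)
  interpret F: comm_group F by (rule F)
  have oneF: "\<one>\<^bsub>F\<^esub> = 0" by (simp add: F_def)
  have jF: "j x \<in> carrier F" if "x \<in> S" for x using that by (auto simp: j_def F_def)
  have top\<T>: "topspace T' = carrier F" if "T' \<in> \<T>" for T'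
    using that by (simp add: \<T>_def abelian_topological_group_def)
  have pull: "pullback_topology (carrier F) h TH \<in> \<T>"
    if H: "abelian_topological_group H TH" "h \<in> hom F H" "continuous_map ?X TH (h \<circ> j)"
    for H :: "('h, 'n) monoid_scheme" and h TH
    unfolding \<T>_def using pullback_abelian_topological_group[OF F H(1,2)] H(3) jF by auto
  have disc: "abelian_topological_group F (discrete_topology (carrier F))"
    using F by (auto simp: abelian_topological_group_def F.m_closed simp del: carrier_free_Abelian_group_iff
                  simp flip: prod_topology_discrete_topology)
  have "pullback_topology (carrier F) (\<lambda>_. \<one>\<^bsub>F\<^esub>) (discrete_topology (carrier F)) \<in> \<T>"
    by (rule pull[OF disc]) (simp_all add: hom_def comp_def)
  then obtain I where I: "I \<in> \<T>" by blast
  have tT: "topspace T = carrier F"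
  proof -
    have "\<Union> {U. \<exists>T'\<in>\<T>. openin T' U} = carrier F"
    proof
      show "\<Union> {U. \<exists>T'\<in>\<T>. openin T' U} \<subseteq> carrier F"
        using top\<T> openin_subset by blast
      have "openin I (carrier F)" using openin_topspace[of I] top\<T>[OF I] by simp
      then show "carrier F \<subseteq> \<Union> {U. \<exists>T'\<in>\<T>. openin T' U}" using I by blast
    qed
    then show ?thesis by (simp add: T_def)
  qed
  have into: "continuous_map Y T g" if g: "\<And>T'. T' \<in> \<T> \<Longrightarrow> continuous_map Y T' g"
    for Y :: "'y topology" and g
    unfolding T_def
  proof (rule continuous_on_generated_topo)
    show "openin Y (g -` U \<inter> topspace Y)" if "U \<in> {U. \<exists>T'\<in>\<T>. openin T' U}" for U
      using that g by (auto simp: continuous_map_alt)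
    have "g ` topspace Y \<subseteq> topspace T"
      using g[OF I] top\<T>[OF I] tT by (auto simp: continuous_map_def)
    then show "g ` topspace Y \<subseteq> \<Union> {U. \<exists>T'\<in>\<T>. openin T' U}" by (simp add: T_def)
  qed
  have finer: "continuous_map T T' id" if T': "T' \<in> \<T>" for T'
    unfolding continuous_map_alt
  proof (intro conjI strip)
    fix U assume U: "openin T' U"
    then have "openin T U" unfolding T_def using T' by (intro topology_generated_by_Basis) auto
    then show "openin T (id -` U \<inter> topspace T)" by auto
  qed (use T' top\<T> tT in auto)
  have atg: "abelian_topological_group F T"
    unfolding abelian_topological_group_def
  proof (intro conjI)
    show "continuous_map (prod_topology T T) T (\<lambda>(x, y). x \<otimes>\<^bsub>F\<^esub> y)"
    proof (rule into)
      fix T' assume T': "T' \<in> \<T>"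
      have "continuous_map (prod_topology T T) (prod_topology T' T') (\<lambda>p. (id (fst p), id (snd p)))"
        by (rule continuous_map_pairedI)
           (use continuous_map_compose[OF continuous_map_fst finer[OF T']]
                continuous_map_compose[OF continuous_map_snd finer[OF T']] in \<open>auto simp: comp_def\<close>)
      moreover have "continuous_map (prod_topology T' T') T' (\<lambda>(x, y). x \<otimes>\<^bsub>F\<^esub> y)"
        using T' by (simp add: \<T>_def abelian_topological_group_def)
      ultimately show "continuous_map (prod_topology T T) T' (\<lambda>(x, y). x \<otimes>\<^bsub>F\<^esub> y)"
        using continuous_map_compose by (fastforce simp: comp_def)
    qed
    show "continuous_map T T (\<lambda>x. inv\<^bsub>F\<^esub> x)"
    proof (rule into)
      fix T' assume T': "T' \<in> \<T>"
      then have "continuous_map T' T' (\<lambda>x. inv\<^bsub>F\<^esub> x)"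
        by (simp add: \<T>_def abelian_topological_group_def)
      from continuous_map_compose[OF finer[OF T'] this]
      show "continuous_map T T' (\<lambda>x. inv\<^bsub>F\<^esub> x)" by (simp add: comp_def)
    qed
  qed (use F tT in auto)
  have cj: "continuous_map ?X T j" by (rule into) (simp add: \<T>_def)
  have ext: "\<exists>h. h \<in> hom F H \<and> continuous_map T TH h \<and> (\<forall>x\<in>S. h (j x) = f x)"
    if H: "abelian_topological_group H TH" and f: "continuous_map ?X TH f" "f e = \<one>\<^bsub>H\<^esub>"
    for H :: "('h, 'n) monoid_scheme" and TH f
  proof -
    interpret H: comm_group H using H by (simp add: abelian_topological_group_def)
    have "f ` (S - {e}) \<subseteq> carrier H"
      using f H by (auto simp: abelian_topological_group_def continuous_map_def)
    then obtain h where h: "h \<in> hom F H" "\<And>x. x \<in> S - {e} \<Longrightarrow> h (frag_of x) = f x"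
      using H.free_Abelian_group_universal unfolding F_def by metis
    have "h \<one>\<^bsub>F\<^esub> = \<one>\<^bsub>H\<^esub>" using hom_one[OF h(1)] F.is_group H.is_group by blast
    then have hj: "h (j x) = f x" if "x \<in> S" for x
      using that h(2) f(2) by (simp add: j_def oneF)
    have "continuous_map ?X TH (h \<circ> j)" by (rule continuous_map_eq[OF f(1)]) (simp add: hj)
    then have "continuous_map T (pullback_topology (carrier F) h TH) id"
      using pull[OF H h(1)] finer by blast
    moreover have "continuous_map (pullback_topology (carrier F) h TH) TH h"
      using continuous_map_pullback[OF continuous_map_id, of "carrier F" h TH] by (simp add: comp_def)
    ultimately have "continuous_map T TH h" using continuous_map_compose by fastforce
    then show ?thesis using h hj by blast
  qed
  have emb: "embedding_map ?X T j"
  proof -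
    define R :: "real monoid" where "R = \<lparr>carrier = UNIV, monoid.mult = (+), one = 0\<rparr>"
    have Rg: "comm_group R"
    proof (rule comm_groupI)
      show "\<exists>y\<in>carrier R. y \<otimes>\<^bsub>R\<^esub> x = \<one>\<^bsub>R\<^esub>" for x
        by (rule bexI[of _ "- x"]) (auto simp: R_def)
    qed (auto simp: R_def)
    interpret R: comm_group R by (rule Rg)
    have invR: "inv\<^bsub>R\<^esub> x = - x" for x by (rule R.inv_equality) (auto simp: R_def)
    have R: "abelian_topological_group R euclidean"
      using Rg by (auto simp: abelian_topological_group_def invR euclidean_product_topology split_def
                        intro!: continuous_intros) (auto simp: R_def intro!: continuous_intros)
    have "continuous_map ?X euclidean (\<lambda>x. x - e)" by (auto intro!: continuous_intros)
    from ext[OF R this] obtain h where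
      h: "continuous_map T euclidean h" "\<And>x. x \<in> S \<Longrightarrow> h (j x) = x - e"
      by (auto simp: R_def)
    have "continuous_map T euclidean (\<lambda>a. h a + e)"
      using h(1) by (auto intro!: continuous_intros)
    then have "continuous_map (subtopology T (j ` S)) ?X (\<lambda>a. h a + e)"
      using h(2) by (auto simp: continuous_map_in_subtopology continuous_map_from_subtopology)
    then have "homeomorphic_maps ?X (subtopology T (j ` S)) j (\<lambda>a. h a + e)"
      using cj h(2) by (auto simp: homeomorphic_maps_def continuous_map_in_subtopology)
    then show ?thesis by (auto simp: embedding_map_def homeomorphic_map_maps)
  qed
  have uniq: "h1 = h2"
    if H: "abelian_topological_group H TH"
      and 1: "h1 \<in> hom F H" "h1 \<in> extensional (carrier F)"
      and 2: "h2 \<in> hom F H" "h2 \<in> extensional (carrier F)" and eq: "\<forall>x\<in>S. h1 (j x) = h2 (j x)"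
    for H :: "(bool \<times> (real \<Rightarrow>\<^sub>0 int)) list monoid" and TH h1 h2
  proof -
    interpret H: comm_group H using H by (simp add: abelian_topological_group_def)
    interpret h1: group_hom F H h1
      using 1 by (simp add: group_hom_def group_hom_axioms_def F.is_group H.is_group)
    interpret h2: group_hom F H h2
      using 2 by (simp add: group_hom_def group_hom_axioms_def F.is_group H.is_group)
    have inv: "- y \<in> carrier F" "x - y = x \<otimes>\<^bsub>F\<^esub> inv\<^bsub>F\<^esub> y"
      if "y \<in> carrier F" for x y
      using that by (auto simp: F_def)
    have "h1 a = h2 a" if "Poly_Mapping.keys a \<subseteq> S - {e}" for a
      using that
    proof (rule free_Abelian_group_induct)
      show "h1 0 = h2 0" using h1.hom_one h2.hom_one by (simp add: oneF)
      show "h1 (x - y) = h2 (x - y)"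
        if "Poly_Mapping.keys x \<subseteq> S - {e}" "Poly_Mapping.keys y \<subseteq> S - {e}"
          "h1 x = h2 x" "h1 y = h2 y" for x y
      proof -
        have "x \<in> carrier F" "y \<in> carrier F" using that by (auto simp: F_def)
        then show ?thesis using that inv by simp
      qed
      show "h1 (frag_of x) = h2 (frag_of x)" if "x \<in> S - {e}" for x
        using eq that by (auto simp: j_def split: if_splits)
    qed
    then show ?thesis using 1 2 by (intro extensionalityI) (auto simp: F_def)
  qed
  have "graev_free_abelian_group F T ?X e j"
    unfolding graev_free_abelian_group_def
  proof (intro conjI allI impI)
    show "completely_regular_space ?X"
      by (intro metrizable_imp_completely_regular_space metrizable_space_subtopology
                metrizable_space_euclidean)
    show "Hausdorff_space ?X" by (intro Hausdorff_space_subtopology Hausdorff_space_euclidean)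
    show "e \<in> topspace ?X" using e by simp
    show "j e = \<one>\<^bsub>F\<^esub>" by (simp add: j_def oneF)
    fix H :: "(bool \<times> (real \<Rightarrow>\<^sub>0 int)) list monoid" and TH f
    assume a: "abelian_topological_group H TH \<and> continuous_map ?X TH f \<and> f e = \<one>\<^bsub>H\<^esub>"
    then obtain h where h: "h \<in> hom F H" "continuous_map T TH h" "\<forall>x\<in>S. h (j x) = f x"
      using ext by blast
    let ?h = "restrict h (carrier F)"
    have "?h \<in> hom F H \<inter> extensional (carrier F)" using h(1) by (auto simp: hom_def Pi_def)
    moreover have "continuous_map T TH ?h" by (rule continuous_map_eq[OF h(2)]) (simp add: tT)
    moreover have "\<forall>x\<in>topspace ?X. ?h (j x) = f x" using h(3) jF by simp
    ultimately show "\<exists>!h. h \<in> hom F H \<inter> extensional (carrier F) \<and> continuous_map T TH h \<and>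
                      (\<forall>x\<in>topspace ?X. h (j x) = f x)"
      using a uniq by (intro ex1I[of _ ?h]) auto
  qed (use atg emb in auto)
  then show ?thesis ..
qed

end

theory Submission
  imports Defs
begin

text \<open>
  Let \<open>e n\<close> be the difference between the \<open>n\<close>-th point of the sequence and its limit. These elements form
  a null sequence that freely generates the Graev free group, and the continuous characters are the
  homomorphisms \<open>\<phi>\<close> to the circle with \<open>\<phi> (e n) \<longlonglongrightarrow> 1\<close> (\<open>graev_conv_seq_free_on_null_sequence\<close>).

  For an element \<open>z\<close> of the circle let \<open>delta z k\<close> be the character with value \<open>z\<close> at \<open>e k\<close> and \<open>1\<close> at the
  other generators, and refine the given topology \<open>T\<close> by the requirement that all \<open>delta z k\<close> be continuous
  uniformly in \<open>k\<close>. The refinement is strictly finer than \<open>T\<close> when \<open>z \<noteq> 1\<close>, because \<open>delta z n (e n) = z\<close>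
  prevents \<open>e\<close> from being null, and it inherits local quasi-convexity from \<open>T\<close>, since a neighbourhood of
  \<open>1\<close> in the circle is cut out by half-plane conditions on finitely many powers
  (\<open>lqc_group_uniform_refinement\<close>). If \<open>z\<close> is an irrational rotation, the refinement has no new continuous
  characters (\<open>compatible_delta_refinement\<close>): a new one would stay away from \<open>1\<close> along a subsequence of
  \<open>e\<close>, and its values on sums of multiples of many far generators, chosen by Kronecker's theorem so as
  to be small in the refinement, would then be far from \<open>1\<close>. So \<open>T\<close> is not a maximal compatible topology,
  that is, it is not quasi-Mackey.

  A Mackey topology associated with \<open>T\<close> would be finer than the refinements for both \<open>z\<close> and \<open>-z\<close>. Where
  \<open>z ^ j\<close> and \<open>(-z) ^ j\<close> are both close to \<open>1\<close>, the exponent \<open>j\<close> is even, so the elements with even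
  exponents would form an open subgroup. The character with value \<open>-1\<close> at every generator is trivial on
  it and would be continuous (\<open>parity_continuous\<close>), although its values do not tend to \<open>1\<close> along \<open>e\<close>.
\<close>

section \<open>The circle group\<close>

lemma carrier_circle_group [simp]: "carrier circle_group = sphere 0 1"
  and mult_circle_group [simp]: "x \<otimes>\<^bsub>circle_group\<^esub> y = x * y"
  and one_circle_group [simp]: "\<one>\<^bsub>circle_group\<^esub> = 1"
  by (simp_all add: circle_group_def)

lemma comm_group_circle_group: "comm_group circle_group"
proof (rule comm_groupI)
  show "\<exists>y\<in>carrier circle_group. y \<otimes>\<^bsub>circle_group\<^esub> x = \<one>\<^bsub>circle_group\<^esub>"
    if "x \<in> carrier circle_group" for x
    using that by (intro bexI[of _ "inverse x"]) (auto simp: norm_inverse intro!: left_inverse)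
qed (auto simp: norm_mult)

lemma inv_circle_group:
  assumes "norm x = 1"
  shows "inv\<^bsub>circle_group\<^esub> x = inverse x"
proof -
  interpret comm_group circle_group by (rule comm_group_circle_group)
  show ?thesis using assms by (intro inv_equality) (auto simp: norm_inverse intro!: left_inverse)
qed

lemma abelian_topological_circle_group:
  "abelian_topological_group circle_group (top_of_set (sphere 0 1))"
  unfolding abelian_topological_group_def
proof (intro conjI)
  let ?C = "top_of_set (sphere 0 1 :: complex set)"
  have "prod_topology ?C ?C = top_of_set (sphere 0 1 \<times> sphere 0 1)"
    by (simp add: subtopology_Times euclidean_product_topology[symmetric])
  then show "continuous_map (prod_topology ?C ?C) ?C (\<lambda>(x, y). x \<otimes>\<^bsub>circle_group\<^esub> y)"
    by (auto simp: split_def norm_mult intro!: continuous_intros)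
  have "continuous_map ?C ?C inverse"
    by (auto simp: norm_inverse intro!: continuous_intros)
  then show "continuous_map ?C ?C (\<lambda>x. inv\<^bsub>circle_group\<^esub> x)"
    by (rule continuous_map_eq) (simp add: inv_circle_group)
qed (simp_all add: comm_group_circle_group)

lemma norm_circle_hom:
  assumes "\<phi> \<in> hom G circle_group" "x \<in> carrier G"
  shows "norm (\<phi> x) = 1"
  using assms by (auto simp: hom_def)

lemma circle_hom_mult:
  assumes "\<phi> \<in> hom G circle_group" "x \<in> carrier G" "y \<in> carrier G"
  shows "\<phi> (x \<otimes>\<^bsub>G\<^esub> y) = \<phi> x * \<phi> y"
  using assms by (auto simp: hom_def)

lemma circle_hom_one:
  assumes "comm_group G" "\<phi> \<in> hom G circle_group"
  shows "\<phi> \<one>\<^bsub>G\<^esub> = 1"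
  using hom_one[OF assms(2)] assms(1) comm_group_circle_group by (simp add: comm_group_def)

lemma circle_hom_inv:
  assumes "comm_group G" "\<phi> \<in> hom G circle_group" "x \<in> carrier G"
  shows "\<phi> (inv\<^bsub>G\<^esub> x) = inverse (\<phi> x)"
proof -
  interpret group_hom G circle_group \<phi>
    using assms comm_group_circle_group
    by (simp add: group_hom_def group_hom_axioms_def comm_group_def)
  show ?thesis using assms hom_inv inv_circle_group norm_circle_hom by metis
qed

lemma circle_hom_nat_pow:
  assumes "comm_group G" "\<phi> \<in> hom G circle_group" "x \<in> carrier G"
  shows "\<phi> (x [^]\<^bsub>G\<^esub> (n::nat)) = \<phi> x ^ n"
proof -
  interpret G: comm_group G by fact
  show ?thesis
    using assms by (induction n) (simp_all add: circle_hom_one circle_hom_mult)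
qed

lemma circle_hom_times:
  assumes "\<phi> \<in> hom G circle_group" "\<psi> \<in> hom G circle_group"
  shows "(\<lambda>x. \<phi> x * \<psi> x) \<in> hom G circle_group"
  using assms by (auto simp: hom_def Pi_def norm_mult)

lemma circle_hom_power:
  assumes "\<phi> \<in> hom G circle_group"
  shows "(\<lambda>x. \<phi> x ^ n) \<in> hom G circle_group"
  using assms by (auto simp: hom_def Pi_def norm_power power_mult_distrib)

lemma restrict_hom_circle:
  assumes "comm_group G" "\<phi> \<in> hom G circle_group"
  shows "restrict \<phi> (carrier G) \<in> hom G circle_group"
proof -
  interpret comm_group G by fact
  show ?thesis using assms by (auto simp: hom_def Pi_def)
qed

lemma circle_mult_diff:
  fixes a b c d :: complex
  assumes "norm b = 1" "norm c = 1"
  shows "norm (a * b - c * d) \<le> norm (a - c) + norm (b - d)"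
proof -
  have "a * b - c * d = (a - c) * b + c * (b - d)" by (simp add: algebra_simps)
  then have "norm (a * b - c * d) \<le> norm ((a - c) * b) + norm (c * (b - d))"
    by (metis norm_triangle_ineq)
  then show ?thesis using assms by (simp add: norm_mult)
qed

text \<open>
  Squaring a point \<open>v\<close> of the right half circle multiplies its distance to \<open>1\<close> by at least \<open>sqrt 2\<close>,
  because \<open>v\<^sup>2 - 1 = (v - 1) (v + 1)\<close> and the squared modulus of \<open>v + 1\<close> is \<open>2 + 2 Re v\<close>.
\<close>

lemma circle_doubling:
  fixes w :: complex
  assumes "norm w = 1" "\<And>i. i < N \<Longrightarrow> Re (w ^ (2 ^ i)) \<ge> 0"
  shows "sqrt 2 ^ N * norm (w - 1) \<le> norm (w ^ (2 ^ N) - 1)"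
  using assms(2)
proof (induction N)
  case (Suc N)
  define v where "v = w ^ (2 ^ N)"
  have v: "norm v = 1" "Re v \<ge> 0" using assms(1) Suc.prems[of N] by (simp_all add: v_def norm_power)
  have "(norm (v + 1))\<^sup>2 = 2 + 2 * Re v"
    using v(1) unfolding cmod_power2 by (simp add: cmod_def power2_eq_square algebra_simps)
  then have "sqrt 2 \<le> norm (v + 1)"
    using v(2) by (intro real_le_lsqrt) auto
  then have "sqrt 2 * norm (v - 1) \<le> norm (v + 1) * norm (v - 1)"
    by (intro mult_right_mono) auto
  also have "\<dots> = norm (w ^ (2 ^ Suc N) - 1)"
    by (simp add: v_def norm_mult[symmetric] algebra_simps power_mult power2_eq_square power_mult[symmetric]
        flip: power_add)
  finally show ?case
    using Suc.IH Suc.prems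
    by (smt (verit) less_Suc_eq mult.assoc mult_left_mono power_Suc real_sqrt_ge_zero v_def)
qed simp

text \<open>
  The doubling estimate cannot be iterated for long, since no two points of the circle are more than
  \<open>2\<close> apart. This is how a neighbourhood of \<open>1\<close> can be cut out by half-plane conditions alone, which
  are the only conditions that quasi-convexity offers.
\<close>

lemma right_half_powers_near_one:
  fixes \<epsilon> :: real
  assumes "\<epsilon> > 0"
  obtains N where "\<And>w :: complex. norm w = 1 \<Longrightarrow> (\<And>i. i < N \<Longrightarrow> Re (w ^ (2 ^ i)) \<ge> 0) \<Longrightarrow> norm (w - 1) < \<epsilon>"
proof -
  obtain N where N: "2 / \<epsilon> < sqrt 2 ^ N"
    using real_arch_pow[of "sqrt 2" "2 / \<epsilon>"] by auto
  show thesis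
  proof (rule that)
    fix w :: complex assume w: "norm w = 1" "\<And>i. i < N \<Longrightarrow> Re (w ^ (2 ^ i)) \<ge> 0"
    have "sqrt 2 ^ N * norm (w - 1) \<le> norm (w ^ (2 ^ N) - 1)"
      using w by (rule circle_doubling)
    also have "\<dots> \<le> 2"
      using norm_triangle_ineq4[of "w ^ (2 ^ N)" 1] w(1) by (simp add: norm_power)
    also have "\<dots> < sqrt 2 ^ N * \<epsilon>" using N assms by (simp add: field_simps)
    finally show "norm (w - 1) < \<epsilon>" by simp
  qed
qed

corollary circle_power_far_from_one:
  fixes w :: complex
  assumes "norm w = 1" "w \<noteq> 1"
  obtains s where "Re (w ^ s) < 0"
proof -
  obtain N where N: "\<And>w' :: complex. norm w' = 1 \<Longrightarrow> (\<And>i. i < N \<Longrightarrow> Re (w' ^ (2 ^ i)) \<ge> 0) \<Longrightarrow>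
      norm (w' - 1) < norm (w - 1)"
    using right_half_powers_near_one[of "norm (w - 1)"] assms by auto
  show thesis using N[OF assms(1)] that by (meson linorder_not_le order_less_irrefl)
qed

lemma norm_circle_power_diff_one:
  fixes w :: complex
  assumes "norm w = 1"
  shows "norm (w ^ j - 1) \<le> real j * norm (w - 1)"
  using norm_power_diff[of w 1 j] assms by simp

text \<open>
  Take \<open>d > 0\<close> for which the \<open>d\<close>-th power of the rotation is close to \<open>1\<close>. If \<open>\<psi> ^ d = 1\<close>, then
  \<open>\<psi> ^ t = \<psi>\<close> for all \<open>t\<close> congruent to \<open>1\<close> modulo \<open>d\<close>, and Kronecker's theorem for the irrational number
  \<open>d \<theta>\<close> provides such a \<open>t\<close> for which the \<open>t\<close>-th power of the rotation is close to \<open>1\<close>. The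
  irrationality matters: for a rotation of order \<open>n\<close>, any \<open>\<psi> \<noteq> 1\<close> with \<open>\<psi> ^ n = 1\<close> is a
  counterexample once \<open>\<epsilon>\<close> is small.
\<close>

lemma irrational_rotation_separates:
  fixes \<psi> :: complex
  assumes \<theta>: "\<theta> \<notin> \<rat>" and \<psi>: "\<psi> \<noteq> 1" and \<epsilon>: "\<epsilon> > 0"
  obtains t :: nat where "norm (cis (2 * pi * \<theta>) ^ t - 1) < \<epsilon>" "\<psi> ^ t \<noteq> 1"
proof -
  have dense: "\<exists>k::nat. k > 0 \<and> norm (cis (2 * pi * \<beta>) ^ k * cis (2 * pi * \<gamma>) - 1) < \<epsilon>"
    if \<beta>: "\<beta> \<notin> \<rat>" for \<beta> \<gamma>
  proof -
    obtain h :: int and k :: int where hk: "k > 0" "\<bar>of_int k * \<beta> - of_int h - (- \<gamma>)\<bar> < \<epsilon> / (2 * pi)"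
      using sequence_of_fractional_parts_is_dense[OF \<beta>, of "\<epsilon> / (2 * pi)" "-\<gamma>"] \<epsilon> pi_gt_zero
      by (metis divide_pos_pos mult_2 add_pos_pos)
    define x where "x = of_int k * \<beta> - of_int h + \<gamma>"
    have "cis (2 * pi * \<beta>) ^ nat k * cis (2 * pi * \<gamma>) = cis (2 * pi * x + 2 * pi * of_int h)"
      using hk(1) unfolding x_def Complex.DeMoivre cis_mult
      by (intro arg_cong[where f = cis]) (simp add: algebra_simps of_nat_nat)
    also have "\<dots> = cis (2 * pi * x)"
      using cis_multiple_2pi[of "of_int h"] by (simp flip: cis_mult)
    finally have eq: "cis (2 * pi * \<beta>) ^ nat k * cis (2 * pi * \<gamma>) = cis (2 * pi * x)" .
    have "norm (cis (2 * pi * x) - 1) \<le> \<bar>2 * pi * x\<bar>"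
      using dist_exp_i_1[of "2 * pi * x"] abs_sin_x_le_abs_x[of "2 * pi * x / 2"]
      by (simp add: cis_conv_exp)
    also have "\<dots> < \<epsilon>"
    proof -
      have "\<bar>x\<bar> < \<epsilon> / (2 * pi)" using hk(2) by (simp add: x_def)
      then show ?thesis by (simp add: abs_mult field_simps)
    qed
    finally show ?thesis using eq hk(1) by (intro exI[of _ "nat k"]) auto
  qed
  obtain d where d: "d > 0" "norm (cis (2 * pi * \<theta>) ^ d - 1) < \<epsilon>"
    using dense[OF \<theta>, of 0] by auto
  show thesis
  proof (cases "\<psi> ^ d = 1")
    case False
    then show thesis using that d by blast
  next
    case True
    have "real d * \<theta> \<notin> \<rat>"
    proof
      assume "real d * \<theta> \<in> \<rat>"
      then have "real d * \<theta> / real d \<in> \<rat>" by (intro Rats_divide) auto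
      then show False using \<theta> d(1) by simp
    qed
    from dense[OF this, of \<theta>] obtain q where
      q: "norm (cis (2 * pi * (real d * \<theta>)) ^ q * cis (2 * pi * \<theta>) - 1) < \<epsilon>" by blast
    have "cis (2 * pi * (real d * \<theta>)) ^ q * cis (2 * pi * \<theta>) = cis (2 * pi * \<theta>) ^ (d * q + 1)"
      by (simp add: Complex.DeMoivre cis_mult algebra_simps)
    moreover have "\<psi> ^ (d * q + 1) = \<psi>" using True by (simp add: power_mult)
    ultimately show thesis using that[of "d * q + 1"] q \<psi> by metis
  qed
qed

lemma ex_irrational: "\<exists>\<theta>::real. \<theta> \<notin> \<rat>"
  using countable_rat uncountable_UNIV_real by (metis UNIV_eq_I)

lemma cis_irrational_rotation_ne_1:
  assumes "\<theta> \<notin> \<rat>"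
  shows "cis (2 * pi * \<theta>) \<noteq> 1"
proof
  assume "cis (2 * pi * \<theta>) = 1"
  then have "cos (2 * pi * \<theta>) = 1" by (metis cis.sel(1) one_complex.sel(1))
  then obtain n :: int where "2 * pi * \<theta> = of_int n * 2 * pi" by (auto simp: cos_one_2pi_int)
  then have "\<theta> = of_int n" by simp
  then show False using assms by simp
qed

section \<open>Refining a topology by uniform convergence of a family of functions\<close>

definition uniform_neighbourhood ::
    "'a topology \<Rightarrow> ('k \<Rightarrow> 'a \<Rightarrow> complex) \<Rightarrow> 'a \<Rightarrow> 'a set \<Rightarrow> bool"
  where "uniform_neighbourhood T \<xi> x W \<longleftrightarrow>
    (\<exists>U d. openin T U \<and> x \<in> U \<and> d > 0 \<and> (\<forall>y\<in>U. (\<forall>k. dist (\<xi> k y) (\<xi> k x) < d) \<longrightarrow> y \<in> W))"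

lemma uniform_neighbourhoodI:
  assumes "openin T U" "x \<in> U" "d > 0"
    and "\<And>y. y \<in> U \<Longrightarrow> (\<And>k. dist (\<xi> k y) (\<xi> k x) < d) \<Longrightarrow> y \<in> W"
  shows "uniform_neighbourhood T \<xi> x W"
  using assms unfolding uniform_neighbourhood_def by blast

lemma uniform_neighbourhoodE:
  assumes "uniform_neighbourhood T \<xi> x W"
  obtains U d where "openin T U" "x \<in> U" "d > 0"
    "\<And>y. y \<in> U \<Longrightarrow> (\<And>k. dist (\<xi> k y) (\<xi> k x) < d) \<Longrightarrow> y \<in> W"
  using assms unfolding uniform_neighbourhood_def by blast

text \<open>
  The coarsest topology above \<open>T\<close> that also makes the map \<open>x \<mapsto> (\<xi> k x)\<^sub>k\<close> continuous for the topology of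
  uniform convergence in \<open>k\<close>. Giving the neighbourhoods directly avoids a space of sequences as codomain.
\<close>

definition uniform_refinement :: "'a topology \<Rightarrow> ('k \<Rightarrow> 'a \<Rightarrow> complex) \<Rightarrow> 'a topology"
  where "uniform_refinement T \<xi> =
    topology (\<lambda>W. W \<subseteq> topspace T \<and> (\<forall>x\<in>W. uniform_neighbourhood T \<xi> x W))"

lemma openin_uniform_refinement:
  "openin (uniform_refinement T \<xi>) W \<longleftrightarrow>
    W \<subseteq> topspace T \<and> (\<forall>x\<in>W. uniform_neighbourhood T \<xi> x W)"
proof -
  have Int: "uniform_neighbourhood T \<xi> x (V \<inter> W)"
    if VW: "uniform_neighbourhood T \<xi> x V" "uniform_neighbourhood T \<xi> x W" for x V W
  proof -
    obtain U1 d1 where 1: "openin T U1" "x \<in> U1" "d1 > 0"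
      "\<forall>y\<in>U1. (\<forall>k. dist (\<xi> k y) (\<xi> k x) < d1) \<longrightarrow> y \<in> V"
      using VW(1) by (auto simp: uniform_neighbourhood_def)
    obtain U2 d2 where 2: "openin T U2" "x \<in> U2" "d2 > 0"
      "\<forall>y\<in>U2. (\<forall>k. dist (\<xi> k y) (\<xi> k x) < d2) \<longrightarrow> y \<in> W"
      using VW(2) by (auto simp: uniform_neighbourhood_def)
    show ?thesis unfolding uniform_neighbourhood_def
      by (rule exI[of _ "U1 \<inter> U2"], rule exI[of _ "min d1 d2"]) (use 1 2 in auto)
  qed
  have mono: "uniform_neighbourhood T \<xi> x W"
    if "uniform_neighbourhood T \<xi> x V" "V \<subseteq> W" for x V W
    using that unfolding uniform_neighbourhood_def by blast
  let ?P = "\<lambda>W. W \<subseteq> topspace T \<and> (\<forall>x\<in>W. uniform_neighbourhood T \<xi> x W)"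
  have "?P (V \<inter> W)" if "?P V" "?P W" for V W
    using that Int[of _ V W] by blast
  moreover have "?P (\<Union>\<K>)" if \<K>: "\<forall>K\<in>\<K>. ?P K" for \<K>
  proof (intro conjI ballI)
    fix x assume "x \<in> \<Union>\<K>"
    then obtain K where K: "K \<in> \<K>" "x \<in> K" by blast
    then have "uniform_neighbourhood T \<xi> x K" using \<K> by blast
    then show "uniform_neighbourhood T \<xi> x (\<Union>\<K>)"
      using K(1) by (rule mono[OF _ Union_upper])
  qed (use \<K> in blast)
  ultimately have "istopology ?P" unfolding istopology_def by presburger
  then show ?thesis by (simp add: uniform_refinement_def)
qed

lemma topspace_uniform_refinement [simp]: "topspace (uniform_refinement T \<xi>) = topspace T"
proof -
  have "openin (uniform_refinement T \<xi>) (topspace T)"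
    by (auto simp: openin_uniform_refinement uniform_neighbourhood_def intro!: exI[of _ "1::real"])
  then show ?thesis
    by (metis openin_subset openin_topspace openin_uniform_refinement subset_antisym)
qed

lemma coarser_uniform_refinement: "coarser_topology T (uniform_refinement T \<xi>)"
  unfolding coarser_topology_def openin_uniform_refinement
proof (intro allI impI conjI ballI)
  fix U x assume "openin T U" "x \<in> U"
  then show "uniform_neighbourhood T \<xi> x U" by (intro uniform_neighbourhoodI[of T U x 1]) auto
qed (rule openin_subset)

lemma continuous_map_id_coarser:
  assumes "coarser_topology \<nu> \<mu>" "topspace \<mu> = topspace \<nu>"
  shows "continuous_map \<mu> \<nu> id"
  unfolding continuous_map
proof (intro conjI allI impI)
  fix U assume U: "openin \<nu> U"
  then have "{x \<in> topspace \<mu>. id x \<in> U} = U" using assms(2) openin_subset by fastforce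
  then show "openin \<mu> {x \<in> topspace \<mu>. id x \<in> U}"
    using U assms(1) by (simp add: coarser_topology_def)
qed (use assms in auto)

text \<open>
  The open set is the set of all points of which \<open>W\<close> is a neighbourhood; halving the radius shows that it
  is a neighbourhood of each of its points. The set of points \<open>d\<close>-close to \<open>x\<close> need not be open itself,
  because the supremum over \<open>k\<close> may equal \<open>d\<close>.
\<close>

lemma uniform_neighbourhood_open:
  assumes "uniform_neighbourhood T \<xi> x W"
  obtains V where "openin (uniform_refinement T \<xi>) V" "x \<in> V" "V \<subseteq> W"
proof -
  define V where "V = {y \<in> topspace T. uniform_neighbourhood T \<xi> y W}"
  have "uniform_neighbourhood T \<xi> y V" if y: "y \<in> V" for y
  proof -
    have "uniform_neighbourhood T \<xi> y W" using y by (simp add: V_def)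
    then obtain U d where U: "openin T U" "y \<in> U" "d > 0"
      "\<And>z. z \<in> U \<Longrightarrow> (\<And>k. dist (\<xi> k z) (\<xi> k y) < d) \<Longrightarrow> z \<in> W"
      by (rule uniform_neighbourhoodE) (use that in blast)
    show ?thesis
    proof (rule uniform_neighbourhoodI[of T U y "d / 2"])
      fix z assume z: "z \<in> U" "\<And>k. dist (\<xi> k z) (\<xi> k y) < d / 2"
      have "uniform_neighbourhood T \<xi> z W"
      proof (rule uniform_neighbourhoodI[of T U z "d / 2"])
        fix v assume v: "v \<in> U" "\<And>k. dist (\<xi> k v) (\<xi> k z) < d / 2"
        have "dist (\<xi> k v) (\<xi> k y) < d" for k
          using dist_triangle[of "\<xi> k v" "\<xi> k y" "\<xi> k z"] v(2)[of k] z(2)[of k] by simp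
        then show "v \<in> W" by (rule U(4)[OF v(1)])
      qed (use U z in auto)
      then show "z \<in> V" using z(1) openin_subset[OF U(1)] by (auto simp: V_def)
    qed (use U in auto)
  qed
  then have "openin (uniform_refinement T \<xi>) V" by (auto simp: openin_uniform_refinement V_def)
  moreover have "x \<in> V" 

  proof -
    obtain U where "openin T U" "x \<in> U" using assms by (rule uniform_neighbourhoodE)
    then have "x \<in> topspace T" using openin_subset by blast
    then show ?thesis using assms by (simp add: V_def)
  qed
  moreover have "V \<subseteq> W"
  proof
    fix y assume "y \<in> V"
    then have "uniform_neighbourhood T \<xi> y W" by (simp add: V_def)
    then show "y \<in> W" by (rule uniform_neighbourhoodE) simp
  qed
  ultimately show thesis by (rule that)
qed

lemma continuous_map_into_uniform_refinement:
  assumes f: "continuous_map Y T f"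
    and unif: "\<And>x d. x \<in> topspace Y \<Longrightarrow> d > 0 \<Longrightarrow>
      \<exists>V. openin Y V \<and> x \<in> V \<and> (\<forall>y\<in>V. \<forall>k. dist (\<xi> k (f y)) (\<xi> k (f x)) < d)"
  shows "continuous_map Y (uniform_refinement T \<xi>) f"
  unfolding continuous_map
proof (intro conjI allI impI)
  show "f ` topspace Y \<subseteq> topspace (uniform_refinement T \<xi>)"
    using f by (auto simp: continuous_map_def)
  fix W assume W: "openin (uniform_refinement T \<xi>) W"
  show "openin Y {x \<in> topspace Y. f x \<in> W}"
  proof (subst openin_subopen, intro ballI)
    fix x assume "x \<in> {x \<in> topspace Y. f x \<in> W}"
    then have x: "x \<in> topspace Y" "f x \<in> W" by auto
    then have "uniform_neighbourhood T \<xi> (f x) W" using W by (simp add: openin_uniform_refinement)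
    then obtain U d where U: "openin T U" "f x \<in> U" "d > 0"
      "\<And>y. y \<in> U \<Longrightarrow> (\<And>k. dist (\<xi> k y) (\<xi> k (f x)) < d) \<Longrightarrow> y \<in> W"
      by (rule uniform_neighbourhoodE) (use that in blast)
    obtain V where V: "openin Y V" "x \<in> V" "\<forall>y\<in>V. \<forall>k. dist (\<xi> k (f y)) (\<xi> k (f x)) < d"
      using unif[OF x(1) U(3)] by blast
    have "openin Y {y \<in> topspace Y. f y \<in> U}" using f U(1) by (auto simp: continuous_map)
    then show "\<exists>O'. openin Y O' \<and> x \<in> O' \<and> O' \<subseteq> {x \<in> topspace Y. f x \<in> W}"
      using V U x by (intro exI[of _ "V \<inter> {y \<in> topspace Y. f y \<in> U}"]) (auto intro: openin_Int)
  qed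
qed

lemma uniformly_close_open:
  assumes "x \<in> topspace T" "d > 0"
  obtains V where "openin (uniform_refinement T \<xi>) V" "x \<in> V"
    "\<And>y k. y \<in> V \<Longrightarrow> dist (\<xi> k y) (\<xi> k x) < d"
proof -
  have "uniform_neighbourhood T \<xi> x {y. \<forall>k. dist (\<xi> k y) (\<xi> k x) < d}"
    by (rule uniform_neighbourhoodI[of T "topspace T" x d]) (use assms in auto)
  then obtain V where "openin (uniform_refinement T \<xi>) V" "x \<in> V"
    "V \<subseteq> {y. \<forall>k. dist (\<xi> k y) (\<xi> k x) < d}"
    by (rule uniform_neighbourhood_open)
  then show thesis by (intro that[of V]) auto
qed

text \<open>
  Since circle-valued homomorphisms turn products into products of unimodular numbers, the distances in
  the \<open>k\<close>-th coordinate only add up under multiplication and are preserved by inversion, with no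
  dependence on \<open>k\<close>.
\<close>

lemma abelian_topological_group_uniform_refinement:
  assumes T: "abelian_topological_group G T" and \<xi>: "\<And>k. \<xi> k \<in> hom G circle_group"
  shows "abelian_topological_group G (uniform_refinement T \<xi>)"
proof -
  let ?R = "uniform_refinement T \<xi>"
  have G: "comm_group G" and tT: "topspace T = carrier G"
    and mult: "continuous_map (prod_topology T T) T (\<lambda>(x, y). x \<otimes>\<^bsub>G\<^esub> y)"
    and inv: "continuous_map T T (\<lambda>x. inv\<^bsub>G\<^esub> x)"
    using T by (auto simp: abelian_topological_group_def)
  interpret comm_group G by fact
  have id: "continuous_map ?R T id"
    using coarser_uniform_refinement by (rule continuous_map_id_coarser) simp
  have "continuous_map (prod_topology ?R ?R) ?R (\<lambda>(x, y). x \<otimes>\<^bsub>G\<^esub> y)"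
  proof (rule continuous_map_into_uniform_refinement)
    have "continuous_map (prod_topology ?R ?R) (prod_topology T T) (\<lambda>p. (id (fst p), id (snd p)))"
      using continuous_map_compose[OF continuous_map_fst id]
        continuous_map_compose[OF continuous_map_snd id]
      by (intro continuous_map_pairedI) (auto simp: comp_def)
    then show "continuous_map (prod_topology ?R ?R) T (\<lambda>(x, y). x \<otimes>\<^bsub>G\<^esub> y)"
      using continuous_map_compose[OF _ mult] by (fastforce simp: comp_def)
    fix p :: "'a \<times> 'a" and d :: real
    assume p: "p \<in> topspace (prod_topology ?R ?R)" and d: "d > 0"
    then have p': "fst p \<in> topspace T" "snd p \<in> topspace T" "d / 2 > 0" by auto
    obtain V1 where V1: "openin ?R V1" "fst p \<in> V1"
      "\<And>y k. y \<in> V1 \<Longrightarrow> dist (\<xi> k y) (\<xi> k (fst p)) < d / 2"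
      using uniformly_close_open[OF p'(1,3)] by blast
    obtain V2 where V2: "openin ?R V2" "snd p \<in> V2"
      "\<And>y k. y \<in> V2 \<Longrightarrow> dist (\<xi> k y) (\<xi> k (snd p)) < d / 2"
      using uniformly_close_open[OF p'(2,3)] by blast
    have "dist (\<xi> k (a \<otimes>\<^bsub>G\<^esub> b)) (\<xi> k (fst p \<otimes>\<^bsub>G\<^esub> snd p)) < d" if ab: "a \<in> V1" "b \<in> V2" for a b k
    proof -
      have c: "a \<in> carrier G" "b \<in> carrier G" "fst p \<in> carrier G" "snd p \<in> carrier G"
        using ab p openin_subset[OF V1(1)] openin_subset[OF V2(1)] tT by (auto simp: mem_Times_iff)
      have "norm (\<xi> k a * \<xi> k b - \<xi> k (fst p) * \<xi> k (snd p)) \<le>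
          norm (\<xi> k a - \<xi> k (fst p)) + norm (\<xi> k b - \<xi> k (snd p))"
        by (rule circle_mult_diff) (simp_all add: c norm_circle_hom[OF \<xi>])
      then show ?thesis
        using V1(3)[OF ab(1), of k] V2(3)[OF ab(2), of k] c
        by (simp add: circle_hom_mult[OF \<xi>] dist_norm)
    qed
    then show "\<exists>V. openin (prod_topology ?R ?R) V \<and> p \<in> V \<and>
        (\<forall>y\<in>V. \<forall>k. dist (\<xi> k (case y of (x, y) \<Rightarrow> x \<otimes>\<^bsub>G\<^esub> y)) (\<xi> k (case p of (x, y) \<Rightarrow> x \<otimes>\<^bsub>G\<^esub> y)) < d)"
      using V1 V2 by (intro exI[of _ "V1 \<times> V2"]) (auto simp: openin_prod_Times_iff split_def mem_Times_iff)
  qed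
  moreover have "continuous_map ?R ?R (\<lambda>x. inv\<^bsub>G\<^esub> x)"
  proof (rule continuous_map_into_uniform_refinement)
    show "continuous_map ?R T (\<lambda>x. inv\<^bsub>G\<^esub> x)"
      using continuous_map_compose[OF id inv] by (simp add: comp_def)
    fix x and d :: real assume x: "x \<in> topspace ?R" and d: "d > 0"
    then obtain V where V: "openin ?R V" "x \<in> V" "\<And>y k. y \<in> V \<Longrightarrow> dist (\<xi> k y) (\<xi> k x) < d"
      using uniformly_close_open[of x T d] by auto
    have "dist (\<xi> k (inv\<^bsub>G\<^esub> y)) (\<xi> k (inv\<^bsub>G\<^esub> x)) < d" if y: "y \<in> V" for y k
    proof -
      have c: "x \<in> carrier G" "y \<in> carrier G"
        using x y openin_subset[OF V(1)] tT by auto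
      then have n: "norm (\<xi> k x) = 1" "norm (\<xi> k y) = 1" 
        by (simp_all add: norm_circle_hom[OF \<xi>])
      then have "inverse (\<xi> k y) - inverse (\<xi> k x) = - (inverse (\<xi> k y) * (\<xi> k y - \<xi> k x) * inverse (\<xi> k x))"
        by (intro inverse_diff_inverse) auto
      then have "norm (inverse (\<xi> k y) - inverse (\<xi> k x)) = norm (\<xi> k y - \<xi> k x)"
        using n by (simp add: norm_mult norm_inverse)
      then show ?thesis using V(3)[OF y, of k] c by (simp add: circle_hom_inv[OF G \<xi>] dist_norm)
    qed
    then show "\<exists>V. openin ?R V \<and> x \<in> V \<and> (\<forall>y\<in>V. \<forall>k. dist (\<xi> k (inv\<^bsub>G\<^esub> y)) (\<xi> k (inv\<^bsub>G\<^esub> x)) < d)"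
      using V by blast
  qed
  ultimately show ?thesis by (simp add: abelian_topological_group_def tT G)
qed

section \<open>Local quasi-convexity of uniform refinements\<close>

lemma continuous_characters_mono:
  assumes "coarser_topology \<nu> \<mu>" "topspace \<mu> = topspace \<nu>"
  shows "continuous_characters G \<nu> \<subseteq> continuous_characters G \<mu>"
  using continuous_map_compose[OF continuous_map_id_coarser[OF assms]]
  by (auto simp: continuous_characters_def)

lemma continuous_characters_hom: "\<phi> \<in> continuous_characters G T \<Longrightarrow> \<phi> \<in> hom G circle_group"
  by (simp add: continuous_characters_def)

lemma restrict_power_continuous_character:
  assumes G: "comm_group G" and T: "topspace T = carrier G" and \<phi>: "\<phi> \<in> continuous_characters G T"
  shows "restrict (\<lambda>x. \<phi> x ^ n) (carrier G) \<in> continuous_characters G T"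
proof -
  have \<phi>_hom: "\<phi> \<in> hom G circle_group" and c: "continuous_map T (top_of_set (sphere 0 1)) \<phi>"
    using \<phi> by (auto simp: continuous_characters_def)
  have "continuous_map (top_of_set (sphere 0 1)) (top_of_set (sphere 0 1)) (\<lambda>z::complex. z ^ n)"
    by (auto simp: norm_power intro!: continuous_intros)
  from continuous_map_compose[OF c this]
  have "continuous_map T (top_of_set (sphere 0 1)) (restrict (\<lambda>x. \<phi> x ^ n) (carrier G))"
    by (rule continuous_map_eq) (simp add: T)
  then show ?thesis
    using restrict_hom_circle[OF G circle_hom_power[OF \<phi>_hom]] by (simp add: continuous_characters_def)
qed

lemma quasi_convex_Int_character_preimages:
  assumes Q: "quasi_convex G T Q"
    and chars: "continuous_characters G T \<subseteq> continuous_characters G R" "\<Phi> \<subseteq> continuous_characters G R"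
  shows "quasi_convex G R {x \<in> Q. \<forall>\<phi>\<in>\<Phi>. \<phi> x \<in> circle_right_half}"
  unfolding quasi_convex_def
proof (intro conjI ballI)
  show "{x \<in> Q. \<forall>\<phi>\<in>\<Phi>. \<phi> x \<in> circle_right_half} \<subseteq> carrier G"
    using Q by (auto simp: quasi_convex_def)
  fix g assume g: "g \<in> carrier G - {x \<in> Q. \<forall>\<phi>\<in>\<Phi>. \<phi> x \<in> circle_right_half}"
  show "\<exists>\<phi>\<in>continuous_characters G R. \<phi> g \<notin> circle_right_half \<and>
      \<phi> ` {x \<in> Q. \<forall>\<phi>\<in>\<Phi>. \<phi> x \<in> circle_right_half} \<subseteq> circle_right_half"
  proof (cases "g \<in> Q")
    case True
    then obtain \<phi> where "\<phi> \<in> \<Phi>" "\<phi> g \<notin> circle_right_half" using g by blast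
    then show ?thesis using chars(2) by (intro bexI[of _ \<phi>]) auto
  next
    case False
    then have "g \<in> carrier G - Q" using g by blast
    then obtain \<phi> where \<phi>: "\<phi> \<in> continuous_characters G T" "\<phi> g \<notin> circle_right_half" "\<phi> ` Q \<subseteq> circle_right_half"
      using Q unfolding quasi_convex_def by meson
    then show ?thesis using chars(1) by (intro bexI[of _ \<phi>]) auto
  qed
qed

text \<open>
  Uniform closeness of all \<open>\<xi> k x\<close> to \<open>1\<close> follows from the conditions \<open>Re (\<xi> k x ^ (2 ^ i)) \<ge> 0\<close> for finitely
  many \<open>i\<close> and all \<open>k\<close>, and these powers are again characters. Intersecting a quasi-convex neighbourhood
  for \<open>T\<close> with the set that they define gives a quasi-convex neighbourhood for the refinement.
\<close>

proposition lqc_group_uniform_refinement: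
  assumes lqc: "lqc_group G T" and \<xi>: "\<And>k. \<xi> k \<in> continuous_characters G T"
  shows "lqc_group G (uniform_refinement T \<xi>)"
proof -
  let ?R = "uniform_refinement T \<xi>"
  have T: "abelian_topological_group G T" and G: "comm_group G" and tT: "topspace T = carrier G"
    and base: "neighbourhood_base_at \<one>\<^bsub>G\<^esub> (quasi_convex G T) T"
    using lqc by (auto simp: lqc_group_def abelian_topological_group_def)
  interpret comm_group G by fact
  have hom: "\<xi> k \<in> hom G circle_group" for k using \<xi> by (rule continuous_characters_hom)
  have one: "\<xi> k \<one>\<^bsub>G\<^esub> = 1" for k using G hom by (rule circle_hom_one)
  have "neighbourhood_base_at \<one>\<^bsub>G\<^esub> (quasi_convex G ?R) ?R"
    unfolding neighbourhood_base_at_def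
  proof (intro allI impI)
    fix W assume W: "openin ?R W \<and> \<one>\<^bsub>G\<^esub> \<in> W"
    then have "uniform_neighbourhood T \<xi> \<one>\<^bsub>G\<^esub> W" by (simp add: openin_uniform_refinement)
    then obtain U d where U: "openin T U" "\<one>\<^bsub>G\<^esub> \<in> U" and d: "d > 0"
      and sub: "\<And>y. y \<in> U \<Longrightarrow> (\<And>k. dist (\<xi> k y) (\<xi> k \<one>\<^bsub>G\<^esub>) < d) \<Longrightarrow> y \<in> W"
      by (rule uniform_neighbourhoodE) (use that in blast)
    obtain U' Q where Q: "openin T U'" "quasi_convex G T Q" "\<one>\<^bsub>G\<^esub> \<in> U'" "U' \<subseteq> Q" "Q \<subseteq> U"
      using base U unfolding neighbourhood_base_at_def by meson
    obtain N where N: "\<And>w :: complex. norm w = 1 \<Longrightarrow> (\<And>i. i < N \<Longrightarrow> Re (w ^ (2 ^ i)) \<ge> 0) \<Longrightarrow>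
        norm (w - 1) < d"
      using right_half_powers_near_one[OF d] by blast
    define \<Phi> where "\<Phi> = {restrict (\<lambda>x. \<xi> k x ^ (2 ^ i)) (carrier G) | k i. i < N}"
    define Q' where "Q' = {x \<in> Q. \<forall>\<phi>\<in>\<Phi>. \<phi> x \<in> circle_right_half}"
    have chars: "continuous_characters G T \<subseteq> continuous_characters G ?R"
      using coarser_uniform_refinement by (rule continuous_characters_mono) simp
    have "\<Phi> \<subseteq> continuous_characters G T"
      unfolding \<Phi>_def using restrict_power_continuous_character[OF G tT \<xi>] by auto
    then have qc: "quasi_convex G ?R Q'"
      unfolding Q'_def using quasi_convex_Int_character_preimages[OF Q(2) chars] chars by blast
    have QG: "Q \<subseteq> carrier G" using Q(2) by (simp add: quasi_convex_def)
    \<comment> \<open>Raising to the power \<open>2 ^ i\<close> expands distances to \<open>1\<close> by at most \<open>2 ^ i \<le> 2 ^ N\<close>, hence the radius.\<close>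
    have "uniform_neighbourhood T \<xi> \<one>\<^bsub>G\<^esub> Q'"
    proof (rule uniform_neighbourhoodI[OF Q(1,3), of "1 / 2 ^ N"])
      fix y assume y: "y \<in> U'" "\<And>k. dist (\<xi> k y) (\<xi> k \<one>\<^bsub>G\<^esub>) < 1 / 2 ^ N"
      have yG: "y \<in> carrier G" using y(1) Q(4) QG by blast
      have "\<xi> k y ^ (2 ^ i) \<in> circle_right_half" if i: "i < N" for k i
      proof -
        have n: "norm (\<xi> k y) = 1" using hom yG by (rule norm_circle_hom)
        have "norm (\<xi> k y ^ (2 ^ i) - 1) \<le> real (2 ^ i) * norm (\<xi> k y - 1)"
          using n by (rule norm_circle_power_diff_one)
        also have "\<dots> \<le> 2 ^ N * (1 / 2 ^ N)"
          using i y(2)[of k] by (intro mult_mono) (auto simp: one dist_norm)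
        finally have "norm (1 - \<xi> k y ^ (2 ^ i)) \<le> 1" by (simp add: norm_minus_commute)
        then have "Re (1 - \<xi> k y ^ (2 ^ i)) \<le> 1" using complex_Re_le_cmod order_trans by blast
        then show ?thesis using n by (simp add: circle_right_half_def norm_power)
      qed
      then show "y \<in> Q'" using y(1) Q(4) yG by (auto simp: Q'_def \<Phi>_def)
    qed simp
    then obtain V where V: "openin ?R V" "\<one>\<^bsub>G\<^esub> \<in> V" "V \<subseteq> Q'"
      by (rule uniform_neighbourhood_open)
    have "Q' \<subseteq> W"
    proof
      fix y assume y: "y \<in> Q'"
      then have yQ: "y \<in> Q" "y \<in> carrier G" using QG by (auto simp: Q'_def)
      have "dist (\<xi> k y) (\<xi> k \<one>\<^bsub>G\<^esub>) < d" for k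
      proof -
        have "norm (\<xi> k y - 1) < d"
        proof (rule N)
          show "norm (\<xi> k y) = 1" using hom yQ(2) by (rule norm_circle_hom)
          fix i assume "i < N"
          then have "restrict (\<lambda>x. \<xi> k x ^ (2 ^ i)) (carrier G) \<in> \<Phi>" by (auto simp: \<Phi>_def)
          then have "restrict (\<lambda>x. \<xi> k x ^ (2 ^ i)) (carrier G) y \<in> circle_right_half"
            using y unfolding Q'_def by blast
          then show "Re (\<xi> k y ^ (2 ^ i)) \<ge> 0" using yQ(2) by (simp add: circle_right_half_def)
        qed
        then show ?thesis by (simp add: one dist_norm)
      qed
      then show "y \<in> W" using sub yQ(1) Q(5) by blast
    qed
    then show "\<exists>U V. openin ?R U \<and> quasi_convex G ?R V \<and> \<one>\<^bsub>G\<^esub> \<in> U \<and> U \<subseteq> V \<and> V \<subseteq> W"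
      using V qc by blast
  qed
  then show ?thesis
    using abelian_topological_group_uniform_refinement[OF T hom] by (simp add: lqc_group_def)
qed

section \<open>Characters and null sequences in abelian topological groups\<close>

lemma continuous_circle_hom_at_one:
  assumes T: "abelian_topological_group G T" and \<phi>: "\<phi> \<in> hom G circle_group"
    and V: "openin T V" "\<one>\<^bsub>G\<^esub> \<in> V" "\<And>x. x \<in> V \<Longrightarrow> \<phi> x = 1"
  shows "continuous_map T (top_of_set (sphere 0 1)) \<phi>"
  unfolding continuous_map
proof (intro conjI allI impI)
  have G: "comm_group G" and tT: "topspace T = carrier G"
    and mult: "continuous_map (prod_topology T T) T (\<lambda>(x, y). x \<otimes>\<^bsub>G\<^esub> y)"
    using T by (auto simp: abelian_topological_group_def)
  interpret comm_group G by fact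
  show "\<phi> ` topspace T \<subseteq> topspace (top_of_set (sphere 0 1))"
    using norm_circle_hom[OF \<phi>] by (auto simp: tT)
  fix U :: "complex set"
  show "openin T {x \<in> topspace T. \<phi> x \<in> U}"
  proof (subst openin_subopen, intro ballI)
    fix x assume x: "x \<in> {x \<in> topspace T. \<phi> x \<in> U}"
    then have xG: "x \<in> carrier G" by (simp add: tT)
    define V' where "V' = {y \<in> topspace T. inv\<^bsub>G\<^esub> x \<otimes>\<^bsub>G\<^esub> y \<in> V}"
    have "continuous_map T (prod_topology T T) (\<lambda>y. (inv\<^bsub>G\<^esub> x, y))"
      by (intro continuous_map_pairedI) (use xG in \<open>auto simp: tT\<close>)
    from continuous_map_compose[OF this mult]
    have "continuous_map T T (\<lambda>y. inv\<^bsub>G\<^esub> x \<otimes>\<^bsub>G\<^esub> y)" by (simp add: comp_def)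
    then have "openin T V'" unfolding V'_def using V(1) by (auto simp: continuous_map)
    moreover have "x \<in> V'" using xG V(2) by (simp add: V'_def tT)
    moreover have "V' \<subseteq> {x \<in> topspace T. \<phi> x \<in> U}"
    proof
      fix y assume "y \<in> V'"
      then have y: "y \<in> carrier G" "\<phi> (inv\<^bsub>G\<^esub> x \<otimes>\<^bsub>G\<^esub> y) = 1" using V(3) by (auto simp: V'_def tT)
      then have "inverse (\<phi> x) * \<phi> y = 1"
        using xG by (simp add: circle_hom_mult[OF \<phi>] circle_hom_inv[OF G \<phi>])
      moreover have "\<phi> x \<noteq> 0" using norm_circle_hom[OF \<phi> xG] by auto
      ultimately have "\<phi> y = \<phi> x" by (simp add: field_simps)
      then show "y \<in> {x \<in> topspace T. \<phi> x \<in> U}" using x y(1) by (simp add: tT)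
    qed
    ultimately show "\<exists>V. openin T V \<and> x \<in> V \<and> V \<subseteq> {x \<in> topspace T. \<phi> x \<in> U}" by blast
  qed
qed

lemma limitin_one_mult:
  assumes T: "abelian_topological_group G T"
    and "limitin T f \<one>\<^bsub>G\<^esub> F" "limitin T g \<one>\<^bsub>G\<^esub> F"
  shows "limitin T (\<lambda>n. f n \<otimes>\<^bsub>G\<^esub> g n) \<one>\<^bsub>G\<^esub> F"
proof -
  have mult: "continuous_map (prod_topology T T) T (\<lambda>(x, y). x \<otimes>\<^bsub>G\<^esub> y)" and G: "comm_group G"
    using T by (auto simp: abelian_topological_group_def)
  interpret comm_group G by fact
  have "limitin (prod_topology T T) (\<lambda>n. (f n, g n)) (\<one>\<^bsub>G\<^esub>, \<one>\<^bsub>G\<^esub>) F"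
    using assms by (simp add: limitin_pairwise comp_def)
  from continuous_map_limit[OF mult this] show ?thesis by (simp add: comp_def)
qed

lemma limitin_one_pow:
  assumes T: "abelian_topological_group G T" and f: "limitin T f \<one>\<^bsub>G\<^esub> F"
  shows "limitin T (\<lambda>n. f n [^]\<^bsub>G\<^esub> (t::nat)) \<one>\<^bsub>G\<^esub> F"
proof -
  have G: "comm_group G" using T by (auto simp: abelian_topological_group_def)
  interpret comm_group G by fact
  show ?thesis
    using limitin_topspace[OF f] by (induction t) (auto intro: limitin_one_mult[OF T] f)
qed

text \<open>
  The product of the \<open>m\<close> consecutive terms that start at index \<open>n\<close>. For fixed \<open>m\<close> it is null in \<open>n\<close> when
  the sequence is, while a character whose values on the sequence tend to \<open>w\<close> tends to
  \<open>w ^ m\<close> along it.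
\<close>

primrec window_product :: "('a, 'm) monoid_scheme \<Rightarrow> (nat \<Rightarrow> 'a) \<Rightarrow> nat \<Rightarrow> nat \<Rightarrow> 'a" where
  "window_product G a 0 n = \<one>\<^bsub>G\<^esub>"
| "window_product G a (Suc m) n = window_product G a m n \<otimes>\<^bsub>G\<^esub> a (n + m)"

lemma limitin_window_product:
  assumes T: "abelian_topological_group G T" and a: "limitin T a \<one>\<^bsub>G\<^esub> sequentially"
  shows "limitin T (window_product G a m) \<one>\<^bsub>G\<^esub> sequentially"
proof (induction m)
  case 0
  then show ?case using limitin_topspace[OF a] by simp
next
  case (Suc m)
  from limitin_one_mult[OF T this limitin_sequentially_offset[OF a, of m]]
  show ?case by (simp add: fun_eq_iff[symmetric])
qed

lemma window_product_closed:
  assumes "comm_group G" "\<And>i. a i \<in> carrier G"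
  shows "window_product G a m n \<in> carrier G"
proof -
  interpret comm_group G by fact
  show ?thesis using assms by (induction m) auto
qed

lemma circle_hom_window_product:
  assumes G: "comm_group G" and a: "\<And>i. a i \<in> carrier G" and \<phi>: "\<phi> \<in> hom G circle_group"
  shows "\<phi> (window_product G a m n) = (\<Prod>i<m. \<phi> (a (n + i)))"
  by (induction m)
    (simp_all add: circle_hom_one[OF G \<phi>] circle_hom_mult[OF \<phi>] window_product_closed[OF G a] a)

section \<open>Groups that are free on a null sequence\<close>

lemma subgroup_circle_hom_equalizer:
  assumes G: "comm_group G" and \<phi>: "\<phi> \<in> hom G circle_group" and \<psi>: "\<psi> \<in> hom G circle_group"
  shows "subgroup {x \<in> carrier G. \<phi> x = \<psi> x} G"
proof -
  interpret comm_group G by fact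
  show ?thesis
  proof (rule subgroupI)
    have "\<one>\<^bsub>G\<^esub> \<in> {x \<in> carrier G. \<phi> x = \<psi> x}" using G \<phi> \<psi> by (simp add: circle_hom_one)
    then show "{x \<in> carrier G. \<phi> x = \<psi> x} \<noteq> {}" by blast
  qed (auto simp: circle_hom_mult[OF \<phi>] circle_hom_mult[OF \<psi>] circle_hom_inv[OF G \<phi>]
      circle_hom_inv[OF G \<psi>])
qed

text \<open>
  The features of the Graev free group over a convergent sequence on which the argument rests: the group
  is freely generated by a null sequence as far as circle-valued homomorphisms can tell, and its
  continuous characters correspond to the sequences in the circle that tend to \<open>1\<close>.
\<close>

locale free_on_null_sequence =
  fixes G :: "('a, 'm) monoid_scheme" (structure) and T :: "'a topology" and e :: "nat \<Rightarrow> 'a"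
  assumes topological_group: "abelian_topological_group G T"
    and e_closed: "e n \<in> carrier G"
    and e_null: "limitin T e \<one>\<^bsub>G\<^esub> sequentially"
    and e_generate: "subgroup D G \<Longrightarrow> range e \<subseteq> D \<Longrightarrow> D = carrier G"
    and circle_hom_exists:
      "(\<And>n. norm (w n) = 1) \<Longrightarrow> \<exists>h. h \<in> hom G circle_group \<inter> extensional (carrier G) \<and> (\<forall>n. h (e n) = w n)"
    and continuous_if_null:
      "h \<in> hom G circle_group \<Longrightarrow> (\<lambda>n. h (e n)) \<longlonglongrightarrow> 1 \<Longrightarrow>
        continuous_map T (top_of_set (sphere 0 1)) h"
begin

sublocale comm_group G
  using topological_group by (simp add: abelian_topological_group_def)

lemma topspace_eq: "topspace T = carrier G"
  using topological_group by (simp add: abelian_topological_group_def)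

lemma circle_hom_eqI:
  assumes \<phi>: "\<phi> \<in> hom G circle_group" and \<psi>: "\<psi> \<in> hom G circle_group"
    and "\<And>n. \<phi> (e n) = \<psi> (e n)" and x: "x \<in> carrier G"
  shows "\<phi> x = \<psi> x"
proof -
  have "subgroup {x \<in> carrier G. \<phi> x = \<psi> x} G"
    using comm_group_axioms \<phi> \<psi> by (rule subgroup_circle_hom_equalizer)
  then have "{x \<in> carrier G. \<phi> x = \<psi> x} = carrier G"
    by (rule e_generate) (use assms e_closed in auto)
  then show ?thesis using x by blast
qed

definition hom_with_values :: "(nat \<Rightarrow> complex) \<Rightarrow> 'a \<Rightarrow> complex"
  where "hom_with_values w =
    (SOME h. h \<in> hom G circle_group \<inter> extensional (carrier G) \<and> (\<forall>n. h (e n) = w n))"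

lemma hom_with_values:
  assumes "\<And>n. norm (w n) = 1"
  shows "hom_with_values w \<in> hom G circle_group" "hom_with_values w \<in> extensional (carrier G)"
    "hom_with_values w (e n) = w n"
  using someI_ex[OF circle_hom_exists[OF assms]] unfolding hom_with_values_def by auto

text \<open>
  For \<open>z\<close> of infinite order these characters read off the coordinates of an element with respect to
  \<open>e\<close>: on an element with exponent \<open>j\<close> at \<open>e k\<close> the value is \<open>z ^ j\<close>.
\<close>

definition delta :: "complex \<Rightarrow> nat \<Rightarrow> 'a \<Rightarrow> complex"
  where "delta z k = hom_with_values (\<lambda>n. if n = k then z else 1)"

lemma delta_hom: "norm z = 1 \<Longrightarrow> delta z k \<in> hom G circle_group"
  unfolding delta_def by (rule hom_with_values) auto

lemma delta_e: "norm z = 1 \<Longrightarrow> delta z k (e n) = (if n = k then z else 1)"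
  unfolding delta_def by (rule hom_with_values) auto

lemma delta_one: "norm z = 1 \<Longrightarrow> delta z k \<one> = 1"
  by (rule circle_hom_one[OF comm_group_axioms delta_hom])

lemma delta_continuous:
  assumes z: "norm z = 1"
  shows "delta z k \<in> continuous_characters G T"
proof -
  have "(\<lambda>n. delta z k (e n)) \<longlonglongrightarrow> 1"
  proof (rule tendsto_eventually)
    show "\<forall>\<^sub>F n in sequentially. delta z k (e n) = 1"
      using eventually_gt_at_top[of k] by eventually_elim (simp add: delta_e z)
  qed
  then show ?thesis
    using continuous_if_null[OF delta_hom[OF z]] delta_hom[OF z] hom_with_values(2)[of "\<lambda>n. if n = k then z else 1"] z
    by (simp add: continuous_characters_def delta_def)
qed

text \<open>
  Each \<open>delta z k\<close> is continuous already, but asking for continuity uniformly in \<open>k\<close> is a new condition,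
  when \<open>z \<noteq> 1\<close>, because \<open>delta z n (e n) = z\<close> for every \<open>n\<close>.
\<close>

definition delta_refinement :: "complex \<Rightarrow> 'a topology"
  where "delta_refinement z = uniform_refinement T (delta z)"

lemma topspace_delta_refinement [simp]: "topspace (delta_refinement z) = carrier G"
  by (simp add: delta_refinement_def topspace_eq)

lemma delta_refinement_ne:
  assumes z: "norm z = 1" "z \<noteq> 1"
  shows "delta_refinement z \<noteq> T"
proof
  assume eq: "delta_refinement z = T"
  obtain V where V: "openin (delta_refinement z) V" "\<one> \<in> V"
    "\<And>y k. y \<in> V \<Longrightarrow> dist (delta z k y) (delta z k \<one>) < dist z 1"
    unfolding delta_refinement_def using uniformly_close_open[of \<one> T "dist z 1" "delta z"] z topspace_eq by auto
  then have "\<forall>\<^sub>F n in sequentially. e n \<in> V" using e_null eq limitinD by metis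
  then obtain n where "e n \<in> V" using eventually_happens by fastforce
  from V(3)[OF this, of n] show False using z(1) by (simp add: delta_e delta_one)
qed

text \<open>
  The heart of the matter: although \<open>e\<close> is no longer null in the refinement, every character of the
  refinement still tends to \<open>1\<close> along \<open>e\<close>. Otherwise \<open>\<phi> (e n)\<close> clusters at some \<open>\<psi> \<noteq> 1\<close>. Choose \<open>t\<close> such
  that \<open>z ^ t\<close> is close to \<open>1\<close> and \<open>\<psi> ^ t \<noteq> 1\<close>, then \<open>m\<close> such that \<open>(\<psi> ^ t) ^ m\<close> lies in the open left
  half-plane. The product of the \<open>t\<close>-th powers of \<open>m\<close> distinct far generators is small for \<open>T\<close>, and all
  its coordinates are \<open>1\<close> or \<open>z ^ t\<close>, so it is small for the refinement; yet \<open>\<phi>\<close> is near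
  \<open>(\<psi> ^ t) ^ m\<close> there.
\<close>

lemma null_if_delta_refinement_continuous:
  assumes \<theta>: "\<theta> \<notin> \<rat>" and \<phi>: "\<phi> \<in> hom G circle_group"
    and cont: "continuous_map (delta_refinement (cis (2 * pi * \<theta>))) (top_of_set (sphere 0 1)) \<phi>"
  shows "(\<lambda>n. \<phi> (e n)) \<longlonglongrightarrow> 1"
proof (rule ccontr)
  define z where "z = cis (2 * pi * \<theta>)"
  have z: "norm z = 1" by (simp add: z_def)
  note G = comm_group_axioms
  assume "\<not> (\<lambda>n. \<phi> (e n)) \<longlonglongrightarrow> 1"
  then obtain \<delta> where \<delta>: "\<delta> > 0" "infinite {n. \<not> dist (\<phi> (e n)) 1 < \<delta>}"
    by (auto simp: tendsto_iff not_eventually INFM_iff_infinite cofinite_eq_sequentially[symmetric])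
  then obtain r :: "nat \<Rightarrow> nat" where r: "strict_mono r" "\<And>n. \<not> dist (\<phi> (e (r n))) 1 < \<delta>"
    using infinite_enumerate by blast
  have "seq_compact (sphere 0 1 :: complex set)"
    using compact_sphere by (simp add: seq_compact_eq_compact)
  moreover have "\<forall>n. \<phi> (e (r n)) \<in> sphere 0 1" using norm_circle_hom[OF \<phi> e_closed] by simp
  ultimately obtain \<psi> r' where \<psi>: "strict_mono r'" "((\<lambda>n. \<phi> (e (r n))) \<circ> r') \<longlonglongrightarrow> \<psi>"
    by (rule seq_compactE)
  define s where "s = r \<circ> r'"
  have s: "strict_mono s" unfolding s_def using r(1) \<psi>(1) by (rule strict_mono_o)
  have lim: "(\<lambda>n. \<phi> (e (s n))) \<longlonglongrightarrow> \<psi>" using \<psi>(2) by (simp add: s_def comp_def)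
  have "\<psi> \<noteq> 1"
  proof
    assume "\<psi> = 1"
    then have "\<forall>\<^sub>F n in sequentially. dist (\<phi> (e (s n))) 1 < \<delta>" using lim \<delta>(1) by (simp add: tendsto_iff)
    then show False using r(2) by (simp add: s_def)
  qed
  have "norm \<psi> = 1"
    using tendsto_norm[OF lim] norm_circle_hom[OF \<phi> e_closed] by (simp add: LIMSEQ_const_iff)
  have "openin (top_of_set (sphere 0 1)) (sphere 0 1 \<inter> {w::complex. Re w > 0})"
    by (intro openin_open_Int open_halfspace_Re_gt)
  with cont have "openin (delta_refinement z) {x \<in> carrier G. \<phi> x \<in> sphere 0 1 \<inter> {w. Re w > 0}}"
    unfolding continuous_map z_def[symmetric] topspace_delta_refinement by blast
  moreover have "\<phi> \<one> = 1" using G \<phi> by (rule circle_hom_one)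
  ultimately have "uniform_neighbourhood T (delta z) \<one> {x \<in> carrier G. \<phi> x \<in> sphere 0 1 \<inter> {w. Re w > 0}}"
    by (simp add: delta_refinement_def openin_uniform_refinement)
  then obtain U \<epsilon> where U: "openin T U" "\<one> \<in> U" "\<epsilon> > 0"
    "\<And>y. y \<in> U \<Longrightarrow> (\<And>k. dist (delta z k y) (delta z k \<one>) < \<epsilon>) \<Longrightarrow> Re (\<phi> y) > 0"
    by (rule uniform_neighbourhoodE) blast
  obtain t where t: "norm (z ^ t - 1) < \<epsilon>" "\<psi> ^ t \<noteq> 1"
    using irrational_rotation_separates[OF \<theta> \<open>\<psi> \<noteq> 1\<close> U(3)] unfolding z_def by blast
  obtain m where m: "Re ((\<psi> ^ t) ^ m) < 0"
    using circle_power_far_from_one[OF _ t(2)] \<open>norm \<psi> = 1\<close> by (auto simp: norm_power)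
  define a where "a n = e (s n) [^] t" for n
  have a: "a n \<in> carrier G" for n by (simp add: a_def e_closed)
  define b where "b = window_product G a m"
  have "limitin T (e \<circ> s) \<one> sequentially" using s e_null by (rule limitin_subsequence)
  from limitin_one_pow[OF topological_group this]
  have "limitin T a \<one> sequentially" by (simp add: a_def[abs_def])
  then have "limitin T b \<one> sequentially" unfolding b_def by (rule limitin_window_product[OF topological_group])
  then have "\<forall>\<^sub>F n in sequentially. b n \<in> U" using U by (intro limitinD)
  moreover have "\<forall>\<^sub>F n in sequentially. Re (\<phi> (b n)) < 0"
  proof -
    have "(\<lambda>n. \<phi> (a (n + i))) \<longlonglongrightarrow> \<psi> ^ t" for i
      unfolding a_def circle_hom_nat_pow[OF G \<phi> e_closed]
      using LIMSEQ_ignore_initial_segment[OF lim, of i] by (intro tendsto_power)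
    then have "(\<lambda>n. \<Prod>i<m. \<phi> (a (n + i))) \<longlonglongrightarrow> (\<Prod>i<m. \<psi> ^ t)" by (intro tendsto_prod)
    then have "(\<lambda>n. Re (\<phi> (b n))) \<longlonglongrightarrow> Re ((\<psi> ^ t) ^ m)"
      by (simp add: b_def circle_hom_window_product[OF G a \<phi>] tendsto_Re)
    then show ?thesis using m by (rule order_tendstoD)
  qed
  ultimately have "\<forall>\<^sub>F n in sequentially. b n \<in> U \<and> Re (\<phi> (b n)) < 0" by (rule eventually_conj)
  then obtain n where n: "b n \<in> U" "Re (\<phi> (b n)) < 0" using eventually_happens by fastforce
  \<comment> \<open>The generators in a window are distinct, so at most one of them contributes to each coordinate.\<close>
  have "dist (delta z k (b n)) (delta z k \<one>) < \<epsilon>" for k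
  proof -
    have eq: "delta z k (b n) = (\<Prod>i<m. if s (n + i) = k then z ^ t else 1)"
      unfolding b_def circle_hom_window_product[OF G a delta_hom[OF z]] a_def
        circle_hom_nat_pow[OF G delta_hom[OF z] e_closed] delta_e[OF z]
      by (intro prod.cong) auto
    show ?thesis
    proof (cases "\<exists>j<m. s (n + j) = k")
      case True
      then obtain j where j: "j < m" "s (n + j) = k" by blast
      have "s (n + i) = k \<longleftrightarrow> i = j" for i
        using j(2) strict_mono_eq[OF s, of "n + i" "n + j"] by auto
      then have "delta z k (b n) = z ^ t" using eq j(1) by simp
      then show ?thesis using t(1) by (simp add: delta_one z dist_norm)
    next
      case False
      then have "delta z k (b n) = 1" unfolding eq by (intro prod.neutral) auto
      then show ?thesis using U(3) by (simp add: delta_one z)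
    qed
  qed
  from U(4)[OF n(1) this] n(2) show False by simp
qed

lemma lqc_delta_refinement:
  assumes "lqc_group G T" "norm z = 1"
  shows "lqc_group G (delta_refinement z)"
  unfolding delta_refinement_def using assms(1) delta_continuous[OF assms(2)] by (rule lqc_group_uniform_refinement)

lemma coarser_delta_refinement: "coarser_topology T (delta_refinement z)"
  unfolding delta_refinement_def by (rule coarser_uniform_refinement)

proposition compatible_delta_refinement:
  assumes \<theta>: "\<theta> \<notin> \<rat>"
  shows "compatible_topologies G T (delta_refinement (cis (2 * pi * \<theta>)))"
  unfolding compatible_topologies_def
proof
  show "continuous_characters G T \<subseteq> continuous_characters G (delta_refinement (cis (2 * pi * \<theta>)))"
    using coarser_delta_refinement by (rule continuous_characters_mono) (simp add: topspace_eq)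
  show "continuous_characters G (delta_refinement (cis (2 * pi * \<theta>))) \<subseteq> continuous_characters G T"
    using null_if_delta_refinement_continuous[OF \<theta>] continuous_if_null by (auto simp: continuous_characters_def)
qed

text \<open>
  The character with value \<open>-1\<close> on every generator records the parity of the sum of all exponents. On
  each element it agrees with the product of sufficiently many \<open>delta (-1) k\<close>; the elements for which
  this holds form a subgroup that contains every generator.
\<close>

lemma parity_determined_by_coordinates:
  assumes x: "x \<in> carrier G" and even: "\<And>k. delta (-1) k x = 1"
  shows "hom_with_values (\<lambda>_. -1) x = 1"
proof -
  note G = comm_group_axioms
  let ?\<psi> = "hom_with_values (\<lambda>_. -1)"
  define P where "P n y = (\<Prod>k<n. delta (-1) k y)" for n y
  define D where "D = {y \<in> carrier G. \<forall>\<^sub>F n in sequentially. ?\<psi> y = P n y}"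
  have \<psi>: "?\<psi> \<in> hom G circle_group" "?\<psi> (e n) = -1" for n by (rule hom_with_values; simp)+
  have \<delta>: "delta (-1) k \<in> hom G circle_group" for k by (rule delta_hom) simp
  have "subgroup D G"
  proof (rule subgroupI)
    have "\<one> \<in> D"
      by (simp add: D_def P_def circle_hom_one[OF G \<psi>(1)] circle_hom_one[OF G \<delta>])
    then show "D \<noteq> {}" by blast
    show "inv y \<in> D" if "y \<in> D" for y
    proof -
      have y: "y \<in> carrier G" "\<forall>\<^sub>F n in sequentially. ?\<psi> y = P n y" using that by (auto simp: D_def)
      have "P n (inv y) = inverse (P n y)" for n
        using y(1) by (simp add: P_def circle_hom_inv[OF G \<delta>] prod_inversef[symmetric] comp_def)
      then show ?thesis using y by (auto simp: D_def circle_hom_inv[OF G \<psi>(1)] elim: eventually_mono)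
    qed
    show "y \<otimes> y' \<in> D" if "y \<in> D" "y' \<in> D" for y y'
    proof -
      have y: "y \<in> carrier G" "y' \<in> carrier G"
        and ev: "\<forall>\<^sub>F n in sequentially. ?\<psi> y = P n y" "\<forall>\<^sub>F n in sequentially. ?\<psi> y' = P n y'"
        using that by (auto simp: D_def)
      have "\<forall>\<^sub>F n in sequentially. ?\<psi> (y \<otimes> y') = P n (y \<otimes> y')"
        using ev by eventually_elim
          (simp add: P_def y circle_hom_mult[OF \<delta>] circle_hom_mult[OF \<psi>(1)] prod.distrib)
      then show ?thesis using y by (simp add: D_def)
    qed
  qed (auto simp: D_def)
  moreover have "e j \<in> D" for j
  proof -
    have "\<forall>\<^sub>F n in sequentially. ?\<psi> (e j) = P n (e j)"
      using eventually_gt_at_top[of j] by eventually_elim (simp add: \<psi>(2) P_def delta_e)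
    then show ?thesis by (simp add: D_def e_closed)
  qed
  ultimately have "D = carrier G" by (intro e_generate) auto
  then have "\<forall>\<^sub>F n in sequentially. ?\<psi> x = P n x" using x by (auto simp: D_def)
  then have "\<forall>\<^sub>F n :: nat in sequentially. ?\<psi> x = 1" by (simp add: P_def even)
  then show ?thesis by simp
qed

text \<open>
  The refinements for \<open>z\<close> and \<open>-z\<close> cannot be bounded by a common compatible topology: if all
  \<open>delta z k x\<close> and all \<open>delta (-z) k x\<close> are close to \<open>1\<close>, then so are their quotients \<open>delta (-1) k x\<close>,
  which are signs. So every exponent of \<open>x\<close> is even, and the parity character is \<open>1\<close> near the identity.
\<close>

lemma parity_continuous:
  assumes M: "abelian_topological_group G M" and z: "norm z = 1"
    and finer: "coarser_topology (delta_refinement z) M" "coarser_topology (delta_refinement (- z)) M"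
  shows "hom_with_values (\<lambda>_. -1) \<in> continuous_characters G M"
proof -
  let ?\<psi> = "hom_with_values (\<lambda>_. -1)"
  have \<psi>: "?\<psi> \<in> hom G circle_group" "?\<psi> \<in> extensional (carrier G)" by (rule hom_with_values; simp)+
  have z': "norm (- z) = 1" using z by simp
  obtain V1 where V1: "openin (delta_refinement z) V1" "\<one> \<in> V1"
    "\<And>y k. y \<in> V1 \<Longrightarrow> dist (delta z k y) (delta z k \<one>) < 1"
    unfolding delta_refinement_def using uniformly_close_open[of \<one> T 1 "delta z"] topspace_eq by auto
  obtain V2 where V2: "openin (delta_refinement (- z)) V2" "\<one> \<in> V2"
    "\<And>y k. y \<in> V2 \<Longrightarrow> dist (delta (- z) k y) (delta (- z) k \<one>) < 1"
    unfolding delta_refinement_def using uniformly_close_open[of \<one> T 1 "delta (- z)"] topspace_eq by auto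
  have "?\<psi> x = 1" if x: "x \<in> V1 \<inter> V2" for x
  proof (rule parity_determined_by_coordinates)
    show xG: "x \<in> carrier G" using x openin_subset[OF V1(1)] by auto
    fix k
    have \<delta>: "delta (-1) k \<in> hom G circle_group" by (rule delta_hom) simp
    have "delta (-1) k x ^ 2 = (\<lambda>_. 1) x"
      by (rule circle_hom_eqI[OF circle_hom_power[OF \<delta>] _ _ xG]) (auto simp: hom_def delta_e)
    then have pm: "delta (-1) k x = 1 \<or> delta (-1) k x = -1" by (simp add: power2_eq_1_iff)
    have prod: "delta (- z) k x = delta z k x * delta (-1) k x"
      by (rule circle_hom_eqI[OF delta_hom[OF z'] circle_hom_times[OF delta_hom[OF z] \<delta>] _ xG])
        (simp add: delta_e z)
    have near: "norm (delta z k x - 1) < 1" "norm (delta (- z) k x - 1) < 1"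
      using x V1(3)[of x k] V2(3)[of x k] by (simp_all add: delta_one z dist_norm)
    \<comment> \<open>Two opposite points of the circle cannot both lie in the open right half-plane.\<close>
    show "delta (-1) k x = 1"
    proof (rule ccontr)
      assume "delta (-1) k x \<noteq> 1"
      then have neg: "delta (- z) k x = - delta z k x" using pm prod by auto
      have "Re (1 - delta z k x) \<le> norm (delta z k x - 1)" "Re (1 - delta (- z) k x) \<le> norm (delta (- z) k x - 1)"
        using complex_Re_le_cmod by (metis norm_minus_commute)+
      then show False using near neg by simp
    qed
  qed
  moreover have "openin M (V1 \<inter> V2)"
    using V1(1) V2(1) finer by (intro openin_Int) (auto simp: coarser_topology_def)
  ultimately have "continuous_map M (top_of_set (sphere 0 1)) ?\<psi>"
    using V1(2) V2(2) by (intro continuous_circle_hom_at_one[OF M \<psi>(1), of "V1 \<inter> V2"]) auto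
  then show ?thesis using \<psi> by (simp add: continuous_characters_def)
qed

theorem not_quasi_Mackey_group: "\<not> quasi_Mackey_group G T"
proof
  assume "quasi_Mackey_group G T"
  then have lqc: "lqc_group G T"
    and max: "\<And>\<nu>. lqc_group G \<nu> \<Longrightarrow> compatible_topologies G T \<nu> \<Longrightarrow> coarser_topology T \<nu> \<Longrightarrow> T = \<nu>"
    by (auto simp: quasi_Mackey_group_def quasi_Mackey_topology_def)
  obtain \<theta> :: real where \<theta>: "\<theta> \<notin> \<rat>" using ex_irrational by blast
  let ?z = "cis (2 * pi * \<theta>)"
  have "lqc_group G (delta_refinement ?z)" using lqc by (rule lqc_delta_refinement) simp
  then have "T = delta_refinement ?z" using compatible_delta_refinement[OF \<theta>] coarser_delta_refinement by (rule max)
  moreover have "delta_refinement ?z \<noteq> T" using cis_irrational_rotation_ne_1[OF \<theta>] by (intro delta_refinement_ne) auto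
  ultimately show False by simp
qed

theorem not_pre_Mackey_group: "\<not> pre_Mackey_group G T"
proof
  assume "pre_Mackey_group G T"
  then obtain M where lqc: "lqc_group G T" and M: "compatible_topologies G T M" "Mackey_group G M"
    by (auto simp: pre_Mackey_group_def)
  have finest: "coarser_topology (delta_refinement (cis (2 * pi * \<theta>))) M" if "\<theta> \<notin> \<rat>" for \<theta>
    using M lqc_delta_refinement[OF lqc, of "cis (2 * pi * \<theta>)"] compatible_delta_refinement[OF that]
    by (simp add: Mackey_group_def compatible_topologies_def)
  obtain \<theta> :: real where \<theta>: "\<theta> \<notin> \<rat>" using ex_irrational by blast
  have \<theta>': "\<theta> + 1 / 2 \<notin> \<rat>"
  proof
    assume "\<theta> + 1 / 2 \<in> \<rat>"
    then have "\<theta> + 1 / 2 - 1 / 2 \<in> \<rat>" by (intro Rats_diff) auto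
    then show False using \<theta> by simp
  qed
  have "cis (2 * pi * (\<theta> + 1 / 2)) = - cis (2 * pi * \<theta>)"
    by (simp add: distrib_left flip: cis_mult)
  then have "coarser_topology (delta_refinement (- cis (2 * pi * \<theta>))) M" using finest[OF \<theta>'] by simp
  moreover have "abelian_topological_group G M"
    using M(2) by (simp add: Mackey_group_def lqc_group_def)
  ultimately have "hom_with_values (\<lambda>_. -1) \<in> continuous_characters G M"
    using finest[OF \<theta>] by (intro parity_continuous[of M "cis (2 * pi * \<theta>)"]) auto
  then have "hom_with_values (\<lambda>_. -1) \<in> continuous_characters G T"
    using M(1) by (simp add: compatible_topologies_def)
  then have "continuous_map T (top_of_set (sphere 0 1)) (hom_with_values (\<lambda>_. -1))"
    by (simp add: continuous_characters_def)
  from continuous_map_limit[OF this e_null]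
  have "(\<lambda>n. hom_with_values (\<lambda>_. -1) (e n)) \<longlonglongrightarrow> hom_with_values (\<lambda>_. -1) \<one>"
    by (simp add: limitin_subtopology comp_def)
  moreover have "hom_with_values (\<lambda>_. -1) (e n) = -1" for n by (rule hom_with_values) simp
  moreover have "hom_with_values (\<lambda>_. -1) \<one> = 1"
    using comm_group_axioms by (rule circle_hom_one) (rule hom_with_values, simp)
  ultimately show False by (simp add: LIMSEQ_const_iff)
qed

end

section \<open>The Graev free group over a convergent sequence\<close>

text \<open>
  Every map into an indiscrete group is continuous, so for such a group the universal property of the
  Graev free group becomes a purely algebraic one.
\<close>

definition indiscrete_topology :: "'a set \<Rightarrow> 'a topology"
  where "indiscrete_topology S = topology (\<lambda>U. U = {} \<or> U = S)"

lemma openin_indiscrete_topology: "openin (indiscrete_topology S) U \<longleftrightarrow> U = {} \<or> U = S"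
proof -
  have "istopology (\<lambda>U. U = {} \<or> U = S)"
    unfolding istopology_def by blast
  then show ?thesis by (simp add: indiscrete_topology_def)
qed

lemma topspace_indiscrete_topology [simp]: "topspace (indiscrete_topology S) = S"
  unfolding topspace_def openin_indiscrete_topology by auto

lemma continuous_map_indiscrete_topology:
  assumes "f \<in> topspace Y \<rightarrow> S"
  shows "continuous_map Y (indiscrete_topology S) f"
proof -
  have "{x \<in> topspace Y. f x \<in> S} = topspace Y" using assms by auto
  then show ?thesis using assms by (auto simp: continuous_map openin_indiscrete_topology)
qed

lemma abelian_topological_indiscrete_group:
  assumes "comm_group H"
  shows "abelian_topological_group H (indiscrete_topology (carrier H))"
proof -
  interpret comm_group H by fact
  show ?thesis
    by (auto simp: abelian_topological_group_def assms intro!: continuous_map_indiscrete_topology)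
qed

text \<open>
  The projection to the quotient by \<open>D\<close> and the trivial homomorphism agree on the space, and both are
  continuous for the indiscrete topology on the quotient. By uniqueness they are equal.
\<close>

lemma graev_generated_by_space:
  assumes F: "graev_free_abelian_group A T X b \<iota>"
    and D: "subgroup D A" "\<iota> ` topspace X \<subseteq> D"
  shows "D = carrier A"
proof -
  have A: "abelian_topological_group A T" using F by (simp add: graev_free_abelian_group_def)
  then have tT: "topspace T = carrier A" by (simp add: abelian_topological_group_def)
  interpret comm_group A using A by (simp add: abelian_topological_group_def)
  let ?Q = "A Mod D"
  have Q: "comm_group ?Q" using D(1) by (rule abelian_FactGroup)
  interpret Q: comm_group ?Q by (rule Q)
  interpret D: normal D A using D(1) by (rule subgroup_imp_normal)
  have one: "\<one>\<^bsub>?Q\<^esub> = D" by (simp add: FactGroup_def)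
  define q where "q = restrict (\<lambda>a. D #>\<^bsub>A\<^esub> a) (carrier A)"
  define c where "c = restrict (\<lambda>_. \<one>\<^bsub>?Q\<^esub>) (carrier A)"
  have q: "q \<in> hom A ?Q \<inter> extensional (carrier A)"
    using D.r_coset_hom_Mod by (auto simp: q_def hom_def Pi_def)
  have c: "c \<in> hom A ?Q \<inter> extensional (carrier A)"
    using Q.r_one[OF Q.one_closed] Q.one_closed unfolding c_def hom_def by simp
  have cont: "continuous_map T (indiscrete_topology (carrier ?Q)) h" if "h \<in> hom A ?Q" for h
    using that by (intro continuous_map_indiscrete_topology) (simp add: tT hom_def)
  have "continuous_map X (indiscrete_topology (carrier ?Q)) (\<lambda>_. \<one>\<^bsub>?Q\<^esub>)"
    using Q.one_closed by (intro continuous_map_indiscrete_topology) blast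
  from graev_free_universal[OF F abelian_topological_indiscrete_group[OF Q] this refl]
  obtain h where uniq: "\<And>h'. h' \<in> hom A ?Q \<inter> extensional (carrier A) \<and>
      continuous_map T (indiscrete_topology (carrier ?Q)) h' \<and>
      (\<forall>x\<in>topspace X. h' (\<iota> x) = \<one>\<^bsub>?Q\<^esub>) \<Longrightarrow> h' = h"
    by (elim ex1E) metis
  have \<iota>D: "\<iota> x \<in> D" "\<iota> x \<in> carrier A" if "x \<in> topspace X" for x
    using that D(2) D.subset by auto
  have "\<forall>x\<in>topspace X. q (\<iota> x) = \<one>\<^bsub>?Q\<^esub>" "\<forall>x\<in>topspace X. c (\<iota> x) = \<one>\<^bsub>?Q\<^esub>"
    using \<iota>D coset_join2[OF _ D(1)] by (simp_all add: q_def c_def one)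
  then have "q = h" "c = h"
    using q c cont by (intro uniq; simp)+
  then have "q = c" by simp
  show ?thesis
  proof
    show "carrier A \<subseteq> D"
    proof
      fix a assume a: "a \<in> carrier A"
      then have "D #>\<^bsub>A\<^esub> a = D" using \<open>q = c\<close> one unfolding q_def c_def by (metis restrict_apply')
      then show "a \<in> D" using a D(1) by (rule coset_join1)
    qed
  qed (rule D.subset)
qed

lemma conv_seq_cases:
  assumes "x \<in> conv_seq"
  obtains "x = 0" | n where "x = 1 / real (Suc n)"
proof -
  have "x = 0 \<or> (\<exists>n. x = 1 / real (Suc n))"
  proof (cases "x = 0")
    case False
    then obtain k where "x = 1 / real k" "k \<ge> 1" using assms by (auto simp: conv_seq_def)
    then show ?thesis by (intro disjI2 exI[of _ "k - 1"]) simp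
  qed simp
  then show thesis using that by blast
qed

lemma inverse_Suc_in_conv_seq: "1 / real (Suc n) \<in> conv_seq"
  unfolding conv_seq_def by (intro insertI2 CollectI exI[of _ "Suc n"]) auto

lemma continuous_on_conv_seq:
  fixes f :: "real \<Rightarrow> 'b::metric_space"
  assumes "(\<lambda>n. f (1 / real (Suc n))) \<longlonglongrightarrow> f 0"
  shows "continuous_on conv_seq f"
  unfolding continuous_on_iff
proof (intro ballI allI impI)
  fix x \<epsilon> :: real assume x: "x \<in> conv_seq" and \<epsilon>: "\<epsilon> > 0"
  from x show "\<exists>d>0. \<forall>x'\<in>conv_seq. dist x' x < d \<longrightarrow> dist (f x') (f x) < \<epsilon>"
  proof (cases rule: conv_seq_cases)
    case 1
    obtain N where N: "\<And>n. n \<ge> N \<Longrightarrow> dist (f (1 / real (Suc n))) (f 0) < \<epsilon>"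
      using assms \<epsilon> by (auto simp: lim_sequentially)
    have "dist (f y) (f 0) < \<epsilon>" if y: "y \<in> conv_seq" "dist y 0 < 1 / real (Suc N)" for y
      using y(1)
    proof (cases rule: conv_seq_cases)
      case (2 n)
      then have "1 / real (Suc n) < 1 / real (Suc N)" using y(2) by (simp add: dist_real_def)
      then have "n \<ge> N" by (simp add: field_simps)
      then show ?thesis using N 2 by simp
    qed (use \<epsilon> in simp)
    then show ?thesis using 1 by (intro exI[of _ "1 / real (Suc N)"]) auto
  next
    case (2 k)
    \<comment> \<open>The gaps shrink towards \<open>0\<close>, so no other point is closer to \<open>x\<close> than the next smaller one.\<close>
    define d where "d = 1 / real (Suc k) - 1 / real (Suc (Suc k))"
    have isolated: "y = x" if y: "y \<in> conv_seq" "dist y x < d" for y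
      using y(1)
    proof (cases rule: conv_seq_cases)
      case 1
      then show ?thesis using y(2) 2 by (simp add: d_def dist_real_def)
    next
      case n: (2 n)
      consider "n = k" | "Suc k \<le> n" | "Suc n \<le> k" by linarith
      then show ?thesis
      proof cases
        case 1
        then show ?thesis using n 2 by simp
      next
        case 2
        then have "1 / real (Suc n) \<le> 1 / real (Suc (Suc k))" by (intro divide_left_mono) auto
        then show ?thesis using y(2) n \<open>x = _\<close> by (simp add: d_def dist_real_def)
      next
        case 3
        then have "1 / real k \<le> 1 / real (Suc n)" by (intro divide_left_mono) auto
        moreover have "1 / real k - 1 / real (Suc k) \<ge> d"
        proof -
          have "d = 1 / (real (Suc k) * real (Suc (Suc k)))" by (simp add: d_def field_simps)
          also have "\<dots> \<le> 1 / (real k * real (Suc k))"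
          proof (rule frac_le)
            show "real k * real (Suc k) \<le> real (Suc k) * real (Suc (Suc k))" by (intro mult_mono) auto
          qed (use 3 in auto)
          also have "\<dots> = 1 / real k - 1 / real (Suc k)" using 3 by (simp add: field_simps)
          finally show ?thesis .
        qed
        ultimately show ?thesis using y(2) n \<open>x = _\<close> by (simp add: dist_real_def)
      qed
    qed
    have "dist (f y) (f x) < \<epsilon>" if "y \<in> conv_seq" "dist y x < d" for y
      using isolated[OF that] \<epsilon> by simp
    moreover have "d > 0" unfolding d_def diff_gt_0_iff_gt by (rule divide_strict_left_mono) auto
    ultimately show ?thesis by blast
  qed
qed

text \<open>
  Subtracting the limit point (in additive notation) makes the generators null and works for every
  choice of the base point \<open>b\<close>: if \<open>b = 0\<close> the limit point is the identity, and if \<open>b = 1 / Suc n\<close> it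
  is the inverse of the \<open>n\<close>-th generator.
\<close>

proposition graev_conv_seq_free_on_null_sequence:
  assumes F: "graev_free_abelian_group A T (top_of_set conv_seq) b \<iota>"
  shows "free_on_null_sequence A T (\<lambda>n. \<iota> (1 / real (Suc n)) \<otimes>\<^bsub>A\<^esub> inv\<^bsub>A\<^esub> (\<iota> 0))"
proof -
  let ?X = "top_of_set conv_seq" and ?C = "top_of_set (sphere 0 1 :: complex set)"
  let ?p = "\<lambda>n. 1 / real (Suc n)"
  have A: "abelian_topological_group A T" and b: "b \<in> conv_seq" and \<iota>b: "\<iota> b = \<one>\<^bsub>A\<^esub>"
    and emb: "embedding_map ?X T \<iota>"
    using F by (auto simp: graev_free_abelian_group_def)
  have tT: "topspace T = carrier A" and G: "comm_group A"
    and mult: "continuous_map (prod_topology T T) T (\<lambda>(x, y). x \<otimes>\<^bsub>A\<^esub> y)"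
    using A by (auto simp: abelian_topological_group_def)
  interpret comm_group A by fact
  have \<iota>: "continuous_map ?X T \<iota>"
    using emb unfolding embedding_map_def
    by (metis continuous_map_in_subtopology homeomorphic_imp_continuous_map)
  have zero: "0 \<in> conv_seq" by (simp add: conv_seq_def)
  have \<iota>A: "\<iota> x \<in> carrier A" if "x \<in> conv_seq" for x
    using \<iota> that tT by (auto simp: continuous_map_def)
  note \<iota>0 = \<iota>A[OF zero] and \<iota>p = \<iota>A[OF inverse_Suc_in_conv_seq]
  define e where "e n = \<iota> (?p n) \<otimes>\<^bsub>A\<^esub> inv\<^bsub>A\<^esub> (\<iota> 0)" for n
  have eA: "e n \<in> carrier A" for n using \<iota>0 \<iota>p by (simp add: e_def)
  have \<iota>e: "\<iota> (?p n) = e n \<otimes>\<^bsub>A\<^esub> \<iota> 0" for n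
    using \<iota>0 \<iota>p[of n] by (simp add: e_def m_assoc)
  have he: "h (e n) = h (\<iota> (?p n)) * inverse (h (\<iota> 0))" if "h \<in> hom A circle_group" for h n
    using \<iota>0 \<iota>p by (simp add: e_def circle_hom_mult[OF that] circle_hom_inv[OF G that])
  have p_lim: "?p \<longlonglongrightarrow> 0" using LIMSEQ_inverse_real_of_nat by (simp add: inverse_eq_divide)
  have "free_on_null_sequence A T e"
  proof
    show "abelian_topological_group A T" by (rule A)
    show "e n \<in> carrier A" for n by (rule eA)
    have "limitin ?X ?p 0 sequentially"
      using p_lim zero inverse_Suc_in_conv_seq by (simp add: limitin_subtopology)
    moreover have "continuous_map ?X (prod_topology T T) (\<lambda>x. (\<iota> x, inv\<^bsub>A\<^esub> (\<iota> 0)))"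
      using \<iota> \<iota>0 tT by (intro continuous_map_pairedI) auto
    from continuous_map_compose[OF this mult]
    have "continuous_map ?X T (\<lambda>x. \<iota> x \<otimes>\<^bsub>A\<^esub> inv\<^bsub>A\<^esub> (\<iota> 0))" by (simp add: comp_def)
    ultimately have "limitin T ((\<lambda>x. \<iota> x \<otimes>\<^bsub>A\<^esub> inv\<^bsub>A\<^esub> (\<iota> 0)) \<circ> ?p) (\<iota> 0 \<otimes>\<^bsub>A\<^esub> inv\<^bsub>A\<^esub> (\<iota> 0)) sequentially"
      by (intro continuous_map_limit)
    then show "limitin T e \<one>\<^bsub>A\<^esub> sequentially" using \<iota>0 by (simp add: comp_def e_def[abs_def])
    show "D = carrier A" if D: "subgroup D A" "range e \<subseteq> D" for D
    proof (rule graev_generated_by_space[OF F D(1)])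
      interpret D: subgroup D A by (rule D(1))
      have eD: "e n \<in> D" for n using D(2) by blast
      have "\<iota> 0 \<in> D"
        using b
      proof (cases rule: conv_seq_cases)
        case 1
        then show ?thesis using \<iota>b by simp
      next
        case (2 n)
        then have "e n = inv\<^bsub>A\<^esub> (\<iota> 0)" using \<iota>b \<iota>0 by (simp add: e_def)
        then show ?thesis using D.m_inv_closed[OF eD[of n]] \<iota>0 by simp
      qed
      have "\<iota> x \<in> D" if "x \<in> conv_seq" for x
        using that
      proof (cases rule: conv_seq_cases)
        case (2 n)
        then show ?thesis using eD[of n] \<open>\<iota> 0 \<in> D\<close> \<iota>e[of n] by simp
      qed (use \<open>\<iota> 0 \<in> D\<close> in simp)
      then show "\<iota> ` topspace ?X \<subseteq> D" by auto
    qed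
    show "\<exists>h. h \<in> hom A circle_group \<inter> extensional (carrier A) \<and> (\<forall>n. h (e n) = w n)"
      if w: "\<And>n. norm (w n) = 1" for w
    proof -
      define g where "g x = (if x \<in> range ?p then w (inv_into UNIV ?p x) else 1)" for x
      have "inj ?p" by (rule injI) simp
      then have gp: "g (?p n) = w n" for n using inv_f_f[of ?p n] by (simp add: g_def del: of_nat_Suc)
      have g0: "g 0 = 1" by (auto simp: g_def)
      have ng: "norm (g x) = 1" for x using w by (simp add: g_def)
      \<comment> \<open>The normalisation at \<open>b\<close> cancels in the differences that define \<open>e\<close>.\<close>
      define f where "f x = g x / g b" for x
      have "continuous_map ?X (indiscrete_topology (carrier circle_group)) f"
        by (rule continuous_map_indiscrete_topology) (simp add: f_def norm_divide ng)
      moreover have "f b = \<one>\<^bsub>circle_group\<^esub>" using ng[of b] by (auto simp: f_def)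
      ultimately obtain h where h: "h \<in> hom A circle_group \<inter> extensional (carrier A)"
        "\<forall>x\<in>conv_seq. h (\<iota> x) = f x"
        using graev_free_universal[OF F abelian_topological_indiscrete_group[OF comm_group_circle_group]]
        by (metis topspace_euclidean_subtopology)
      have "h (e n) = w n" for n
      proof -
        have "h (e n) = f (?p n) * inverse (f 0)"
          using h zero inverse_Suc_in_conv_seq by (simp add: he del: of_nat_Suc)
        also have "\<dots> = w n" using ng[of b] unfolding f_def gp g0 by auto
        finally show ?thesis .
      qed
      then show ?thesis using h by blast
    qed
    show "continuous_map T ?C h"
      if h: "h \<in> hom A circle_group" and lim: "(\<lambda>n. h (e n)) \<longlonglongrightarrow> 1" for h
    proof -
      have "(\<lambda>n. h (e n) * h (\<iota> 0)) \<longlonglongrightarrow> 1 * h (\<iota> 0)"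
        using lim by (intro tendsto_mult tendsto_const)
      then have "(\<lambda>n. h (\<iota> (?p n))) \<longlonglongrightarrow> h (\<iota> 0)"
        unfolding \<iota>e circle_hom_mult[OF h eA \<iota>0] by simp
      then have "continuous_on conv_seq (\<lambda>x. h (\<iota> x))" by (rule continuous_on_conv_seq)
      then have "continuous_map ?X ?C (\<lambda>x. h (\<iota> x))"
        using norm_circle_hom[OF h \<iota>A] by auto
      moreover have "h (\<iota> b) = \<one>\<^bsub>circle_group\<^esub>" using circle_hom_one[OF G h] \<iota>b by simp
      ultimately obtain h' where h': "h' \<in> hom A circle_group" "continuous_map T ?C h'"
        "\<forall>x\<in>conv_seq. h' (\<iota> x) = h (\<iota> x)"
        using graev_free_universal[OF F abelian_topological_circle_group]
        by (metis IntD1 topspace_euclidean_subtopology)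
      have "{x \<in> carrier A. h' x = h x} = carrier A"
        using F subgroup_circle_hom_equalizer[OF G h'(1) h] h'(3) \<iota>A
        by (intro graev_generated_by_space) auto
      then show ?thesis by (intro continuous_map_eq[OF h'(2)]) (auto simp: tT)
    qed
  qed
  then show ?thesis by (simp add: e_def[abs_def])
qed

theorem theorem1p3:
  fixes A :: "('a, 'm) monoid_scheme" and T :: "'a topology"
    and e :: real and \<iota> :: "real \<Rightarrow> 'a"
  assumes "graev_free_abelian_group A T (top_of_set conv_seq) e \<iota>"
  shows "\<not> pre_Mackey_group A T \<and> \<not> quasi_Mackey_group A T"
proof -
  interpret free_on_null_sequence A T "\<lambda>n. \<iota> (1 / real (Suc n)) \<otimes>\<^bsub>A\<^esub> inv\<^bsub>A\<^esub> (\<iota> 0)"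
    using assms by (rule graev_conv_seq_free_on_null_sequence)
  show ?thesis using not_pre_Mackey_group not_quasi_Mackey_group by blast
qed

end
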